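(* Let $\Omega\subset\mathbb{R}^N$ ($N\ge 2$) be a bounded smooth domain, $0<s<1<p<\infty$, $0<\alpha<1$, and let $\omega\in L^r(\Omega)\setminus\{0\}$ with $\omega\ge 0$ and $r\ge r_\alpha$. Let $u_\alpha\in W_0^{s,p}(\Omega)$ be the unique weak solution of $(-\Delta_p)^s u=\omega u^{-\alpha}$ in $\Omega$, $u>0$ in $\Omega$, $u=0$ on $\mathbb{R}^N\setminus\Omega$, and set $$\mathcal{M}_\alpha:=\Big\{v\in W_0^{s,p}(\Omega):\int_\Omega |v|^{1-\alpha}\omega\,dx=1\Big\},\quad U_\alpha:=\Big(\int_\Omega |u_\alpha|^{1-\alpha}\omega\,dx\Big)^{-\frac{1}{1-\alpha}}u_\alpha,\quad \lambda_\alpha:=\min_{v\in\mathcal{M}_\alpha}[v]_{s,p}^p=[U_\alpha]_{s,p}^p.$$ Then the only minimizers of the functional $v\mapsto[v]_{s,p}^p$ on $\mathcal{M}_\alpha$ are $U_\alpha$ and $-U_\alpha$. Therefore, if $$\lambda_\alpha\left(\int_\Omega|v|^{1-\alpha}\omega\,dx\right)^{\frac{p}{1-\alpha}}=[v]_{s,p}^p$$ for some $v\in W_0^{s,p}(\Omega)\setminus\{0\}$, then $v=kU_\alpha$ for some constant $k$.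
   Context: Gagliardo semi-norm: $[u]_{s,p}:=\left(\iint_{\mathbb{R}^{2N}}\frac{|u(x)-u(y)|^p}{|x-y|^{N+sp}}\,dx\,dy\right)^{1/p}$. $W_0^{s,p}(\Omega)$ is the completion of $C_c^\infty(\Omega)$ with respect to $([u]_{s,p}^p+\|u\|_p^p)^{1/p}$; equivalently $W_0^{s,p}(\Omega)=\{u\in L^p(\mathbb{R}^N):[u]_{s,p}<\infty,\ u=0 \text{ in }\mathbb{R}^N\setminus\Omega\}$, normed by $[\cdot]_{s,p}$. Pairing: $\langle(-\Delta_p)^s u,v\rangle:=\iint_{\mathbb{R}^{2N}}\frac{|u(x)-u(y)|^{p-2}(u(x)-u(y))(v(x)-v(y))}{|x-y|^{N+sp}}\,dx\,dy$ for $u,v\in W_0^{s,p}(\Omega)$. Weak solution: $u\in W_0^{s,p}(\Omega)$ is a weak solution of the singular problem $(-\Delta_p)^s u=\omega u^{-\alpha}$ in $\Omega$, $u>0$ in $\Omega$, $u=0$ on $\mathbb{R}^N\setminus\Omega$, if (i) for each subdomain $\Omega'$ compactly contained in $\Omega$ there is a constant $C_{\Omega'}>0$ with $u\ge C_{\Omega'}$ a.e. in $\Omega'$; and (ii) $\langle(-\Delta_p)^s u,\varphi\rangle=\int_\Omega\frac{\omega\varphi}{u^\alpha}\,dx$ for all $\varphi\in C_c^\infty(\Omega)$. Exponents: $p_s^\star:=\frac{Np}{N-sp}$ if $N>sp$ and $p_s^\star:=\infty$ if $N\le sp$; $t':=t/(t-1)$ is the Hölder conjugate. For $0<\alpha<1$: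 $r_\alpha:=\left(\frac{p_s^\star}{1-\alpha}\right)'$ if $sp<N$, and $r_\alpha:=\alpha^{-1}$ if $sp\ge N$. Under the stated assumptions on $\omega$ and $r$, the weak solution $u_\alpha$ exists and is unique, and the minimum $\lambda_\alpha$ is attained at $U_\alpha$. *)

theory Defs
  imports "HOL-Analysis.Analysis"
begin

text \<open>
  Elements of Lebesgue and Sobolev spaces are represented by Borel measurable functions; equality
  of such elements is equality almost everywhere with respect to \<^term>\<open>lborel\<close>.  The ambient space
  \<open>\<real>\<^sup>N\<close> is a Euclidean space \<^typ>\<open>'a::euclidean_space\<close> with \<open>N = DIM('a)\<close>.
\<close>

subsection \<open>Smooth functions and smooth domains\<close>

primrec C_upto :: "nat \<Rightarrow> ('a::euclidean_space \<Rightarrow> real) \<Rightarrow> bool" where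
  "C_upto 0 f \<longleftrightarrow> continuous_on UNIV f"
| "C_upto (Suc k) f \<longleftrightarrow> (\<forall>x. f differentiable (at x)) \<and>
     (\<forall>b\<in>Basis. C_upto k (\<lambda>x. frechet_derivative f (at x) b))"

definition smooth :: "('a::euclidean_space \<Rightarrow> real) \<Rightarrow> bool" where
  "smooth f \<longleftrightarrow> (\<forall>k. C_upto k f)"

definition test_functions :: "'a::euclidean_space set \<Rightarrow> ('a \<Rightarrow> real) set" where
  "test_functions \<Omega> =
     {\<phi>. smooth \<phi> \<and> (\<exists>K. compact K \<and> K \<subseteq> \<Omega> \<and> (\<forall>x. x \<notin> K \<longrightarrow> \<phi> x = 0))}"

text \<open>
  Near each boundary point, \<open>\<Omega>\<close> is the region strictly above the graph of a smooth function, in the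
  direction of some unit vector \<open>e\<close>.  Only the values of \<open>\<gamma>\<close> on the hyperplane orthogonal to \<open>e\<close>
  are used.
\<close>

definition smooth_boundary :: "'a::euclidean_space set \<Rightarrow> bool" where
  "smooth_boundary \<Omega> \<longleftrightarrow> (\<forall>x0\<in>frontier \<Omega>. \<exists>\<rho>>0. \<exists>e \<gamma>. norm e = 1 \<and> smooth \<gamma> \<and>
     (\<forall>x\<in>ball x0 \<rho>. x \<in> \<Omega> \<longleftrightarrow> \<gamma> (x - (x \<bullet> e) *\<^sub>R e) < x \<bullet> e))"

definition bounded_smooth_domain :: "'a::euclidean_space set \<Rightarrow> bool" where
  "bounded_smooth_domain \<Omega> \<longleftrightarrow>
     open \<Omega> \<and> connected \<Omega> \<and> \<Omega> \<noteq> {} \<and> bounded \<Omega> \<and> smooth_boundary \<Omega>"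


subsection \<open>Fractional Sobolev spaces\<close>

definition gagliardo_integrand ::
  "real \<Rightarrow> real \<Rightarrow> ('a::euclidean_space \<Rightarrow> real) \<Rightarrow> 'a \<times> 'a \<Rightarrow> real" where
  "gagliardo_integrand s p u = (\<lambda>(x, y).
     \<bar>u x - u y\<bar> powr p / norm (x - y) powr (real DIM('a) + s * p))"

text \<open>
  The next two quantities are only meaningful for \<open>u\<close> in the space \<open>frac_sobolev s p\<close> below, since a
  Bochner integral of a function that is not integrable is \<open>0\<close>.
\<close>

definition gagliardo :: "real \<Rightarrow> real \<Rightarrow> ('a::euclidean_space \<Rightarrow> real) \<Rightarrow> real" where
  "gagliardo s p u = (LINT z|(lborel \<Otimes>\<^sub>M lborel). gagliardo_integrand s p u z) powr (1 / p)"

definition frac_sobolev_norm :: "real \<Rightarrow> real \<Rightarrow> ('a::euclidean_space \<Rightarrow> real) \<Rightarrow> real" where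
  "frac_sobolev_norm s p u =
     (gagliardo s p u powr p + (LINT x|lborel. \<bar>u x\<bar> powr p)) powr (1 / p)"

definition frac_sobolev :: "real \<Rightarrow> real \<Rightarrow> ('a::euclidean_space \<Rightarrow> real) set" where
  "frac_sobolev s p = {u. u \<in> borel_measurable lborel \<and>
     integrable lborel (\<lambda>x. \<bar>u x\<bar> powr p) \<and>
     integrable (lborel \<Otimes>\<^sub>M lborel) (gagliardo_integrand s p u)}"

text \<open>
  The completion of the test functions, realised as their closure in the Banach space
  \<open>frac_sobolev s p\<close>.  Its elements vanish almost everywhere outside \<open>\<Omega>\<close>.
\<close>

definition frac_sobolev0 ::
  "real \<Rightarrow> real \<Rightarrow> 'a::euclidean_space set \<Rightarrow> ('a \<Rightarrow> real) set" where
  "frac_sobolev0 s p \<Omega> = {u \<in> frac_sobolev s p.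
     \<exists>\<phi>. (\<forall>n::nat. \<phi> n \<in> test_functions \<Omega>) \<and>
         (\<lambda>n. frac_sobolev_norm s p (\<lambda>x. u x - \<phi> n x)) \<longlonglongrightarrow> 0}"

definition Lebesgue_space :: "ereal \<Rightarrow> 'a::euclidean_space set \<Rightarrow> ('a \<Rightarrow> real) set" where
  "Lebesgue_space r \<Omega> = {f. set_borel_measurable lborel \<Omega> f \<and>
     (if r = \<infinity> then \<exists>C. AE x\<in>\<Omega> in lborel. \<bar>f x\<bar> \<le> C
      else set_integrable lborel \<Omega> (\<lambda>x. \<bar>f x\<bar> powr real_of_ereal r))}"


subsection \<open>The fractional p-Laplacian and the singular problem\<close>

definition frac_p_Laplacian ::
  "real \<Rightarrow> real \<Rightarrow> ('a::euclidean_space \<Rightarrow> real) \<Rightarrow> ('a \<Rightarrow> real) \<Rightarrow> real" where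
  "frac_p_Laplacian s p u v = (LINT (x, y)|(lborel \<Otimes>\<^sub>M lborel).
     \<bar>u x - u y\<bar> powr (p - 2) * (u x - u y) * (v x - v y)
       / norm (x - y) powr (real DIM('a) + s * p))"

definition weak_solution ::
  "real \<Rightarrow> real \<Rightarrow> real \<Rightarrow> 'a::euclidean_space set \<Rightarrow> ('a \<Rightarrow> real) \<Rightarrow> ('a \<Rightarrow> real) \<Rightarrow> bool" where
  "weak_solution s p \<alpha> \<Omega> \<omega> u \<longleftrightarrow> u \<in> frac_sobolev0 s p \<Omega> \<and>
     (\<forall>\<Omega>'. open \<Omega>' \<and> connected \<Omega>' \<and> compact (closure \<Omega>') \<and> closure \<Omega>' \<subseteq> \<Omega> \<longrightarrow>
        (\<exists>C>0. AE x\<in>\<Omega>' in lborel. C \<le> u x)) \<and>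
     (\<forall>\<phi>\<in>test_functions \<Omega>.
        frac_p_Laplacian s p u \<phi> = (LINT x:\<Omega>|lborel. \<omega> x * \<phi> x / u x powr \<alpha>))"

definition hoelder_conjugate :: "real \<Rightarrow> real" where
  "hoelder_conjugate t = t / (t - 1)"

text \<open>The critical Sobolev exponent in the subcritical case \<open>s p < N\<close>, the only case where it is used.\<close>

definition sobolev_exponent :: "real \<Rightarrow> real \<Rightarrow> real \<Rightarrow> real" where
  "sobolev_exponent N s p = N * p / (N - s * p)"

definition weight_exponent :: "real \<Rightarrow> real \<Rightarrow> real \<Rightarrow> real \<Rightarrow> real" where
  "weight_exponent N s p \<alpha> =
     (if s * p < N then hoelder_conjugate (sobolev_exponent N s p / (1 - \<alpha>)) else 1 / \<alpha>)"


subsection \<open>The constrained minimisation problem\<close>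

definition weighted_integral ::
  "real \<Rightarrow> 'a::euclidean_space set \<Rightarrow> ('a \<Rightarrow> real) \<Rightarrow> ('a \<Rightarrow> real) \<Rightarrow> real" where
  "weighted_integral \<alpha> \<Omega> \<omega> v = (LINT x:\<Omega>|lborel. \<bar>v x\<bar> powr (1 - \<alpha>) * \<omega> x)"

definition constraint_set ::
  "real \<Rightarrow> real \<Rightarrow> real \<Rightarrow> 'a::euclidean_space set \<Rightarrow> ('a \<Rightarrow> real) \<Rightarrow> ('a \<Rightarrow> real) set" where
  "constraint_set s p \<alpha> \<Omega> \<omega> = {v \<in> frac_sobolev0 s p \<Omega>. weighted_integral \<alpha> \<Omega> \<omega> v = 1}"

definition normalized ::
  "real \<Rightarrow> 'a::euclidean_space set \<Rightarrow> ('a \<Rightarrow> real) \<Rightarrow> ('a \<Rightarrow> real) \<Rightarrow> 'a \<Rightarrow> real" where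
  "normalized \<alpha> \<Omega> \<omega> u = (\<lambda>x. weighted_integral \<alpha> \<Omega> \<omega> u powr (- 1 / (1 - \<alpha>)) * u x)"

definition minimal_energy ::
  "real \<Rightarrow> real \<Rightarrow> real \<Rightarrow> 'a::euclidean_space set \<Rightarrow> ('a \<Rightarrow> real) \<Rightarrow> real" where
  "minimal_energy s p \<alpha> \<Omega> \<omega> = (INF v\<in>constraint_set s p \<alpha> \<Omega> \<omega>. gagliardo s p v powr p)"

end

theory Submission
  imports Defs
begin

text \<open>
  Write \<open>E\<close> for \<open>[u]\<^sup>p\<close> and \<open>\<langle>u, v\<rangle>\<close> for the pairing.  The functions
  \<open>sqrt (\<epsilon>\<^sup>2 + \<phi>\<^sup>2) - \<epsilon>\<close>, for \<open>\<phi>\<close> a test function, are again test functions and converge to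
  \<open>\<bar>\<phi>\<bar>\<close>, so that Fatou's lemma extends the weak formulation to \<open>\<integral> \<omega> \<bar>v\<bar> / u\<^sup>\<alpha> \<le> \<langle>u, \<bar>v\<bar>\<rangle>\<close>
  for every \<open>v\<close> in the Sobolev space, and by density \<open>E = \<integral> \<omega> u\<^bsup>1-\<alpha>\<^esup>\<close>.  Hoelder's inequality,
  once for the pairing and once for \<open>\<omega> \<bar>v\<bar>\<^bsup>1-\<alpha>\<^esup> = (\<omega> \<bar>v\<bar> / u\<^sup>\<alpha>)\<^bsup>1-\<alpha>\<^esup> (\<omega> u\<^bsup>1-\<alpha>\<^esup>)\<^sup>\<alpha>\<close>,
  then gives \<open>(\<integral> \<omega> \<bar>v\<bar>\<^bsup>1-\<alpha>\<^esup>)\<^bsup>p/(1-\<alpha>)\<^esup> \<le> E\<^bsup>(p-1+\<alpha>)/(1-\<alpha>)\<^esup> [v]\<^sup>p\<close>, with equality for \<open>v = u\<close>.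
  If equality holds for \<open>v\<close>, the equality cases of \<open>\<langle>u, \<bar>v\<bar>\<rangle> \<le> [u]\<^bsup>p-1\<^esup> [v]\<close> yield
  \<open>\<bar>v x\<bar> - \<bar>v y\<bar> = k (u x - u y)\<close> and \<open>\<bar>\<bar>v x\<bar> - \<bar>v y\<bar>\<bar> = \<bar>v x - v y\<bar>\<close> for almost all \<open>(x, y)\<close>.
  Taking \<open>y\<close> outside \<open>\<Omega>\<close> shows \<open>\<bar>v\<bar> = k u\<close>, and the second identity says that \<open>v\<close> has
  constant sign.
\<close>

subsection \<open>Integral inequalities\<close>

text \<open>The bound ln t \<le> t - 1, applied to \<open>x powr p\<close> and
  \<open>y powr p\<close> divided by their weighted mean \<open>m\<close>, gives the inequality.
  Since ln t = t - 1 forces t = 1, it settles the equality case as well.\<close>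

lemma Young_powr:
  fixes p x y :: real
  assumes p: "1 < p" and "0 \<le> x" "0 \<le> y"
  shows "x powr (p - 1) * y \<le> (1 - 1 / p) * x powr p + y powr p / p"
    and "x powr (p - 1) * y = (1 - 1 / p) * x powr p + y powr p / p \<Longrightarrow> x = y"
proof -
  have "x powr (p - 1) * y \<le> (1 - 1 / p) * x powr p + y powr p / p \<and>
     (x powr (p - 1) * y = (1 - 1 / p) * x powr p + y powr p / p \<longrightarrow> x = y)"
  proof (cases "x = 0 \<or> y = 0")
    case True
    \<comment> \<open>If one argument is 0, so is the left-hand side; both coefficients on the right
      are positive, so equality forces the other argument to be 0.\<close>
    have "0 < 1 - 1 / p" using p by simp
    with True p assms show ?thesis by auto
  next
    case False
    with assms have x: "0 < x" and y: "0 < y" by auto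
    define m where "m = (1 - 1 / p) * x powr p + y powr p / p"
    have q: "0 < 1 - 1 / p" using p by simp
    have m: "0 < m" unfolding m_def using q p x y by (intro add_pos_pos) auto
    have l1: "ln (x powr p / m) \<le> x powr p / m - 1" and l2: "ln (y powr p / m) \<le> y powr p / m - 1"
      using x y m by (auto intro!: ln_le_minus_one)
    have "(1 - q) * (X / m - 1) + q * (Y / m - 1) = ((1 - q) * X + Y * q) / m - 1" for q X Y
      using m by (simp add: field_simps)
    \<comment> \<open>Dividing by the weighted mean makes the weighted sum of the two upper bounds
      exactly 0, so the weighted sum of the logarithms is at most 0.\<close>
    from this[of "1 / p" "x powr p" "y powr p"]
    have sum1: "(1 - 1 / p) * (x powr p / m - 1) + (1 / p) * (y powr p / m - 1) = 0"
      using m by (simp add: m_def)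
    have lns: "ln (x powr (p - 1) * y) - ln m
        = (1 - 1 / p) * ln (x powr p / m) + (1 / p) * ln (y powr p / m)"
      using x y m p by (simp add: ln_mult ln_div ln_powr field_simps)
    have a1: "(1 - 1 / p) * ln (x powr p / m) \<le> (1 - 1 / p) * (x powr p / m - 1)"
      using l1 q by (intro mult_left_mono) auto
    have a2: "(1 / p) * ln (y powr p / m) \<le> (1 / p) * (y powr p / m - 1)"
      using l2 p by (intro mult_left_mono) auto
    have "ln (x powr (p - 1) * y) \<le> ln m" using a1 a2 sum1 lns by linarith
    hence le: "x powr (p - 1) * y \<le> m" using m x y by (subst (asm) ln_le_cancel_iff) auto
    have "x = y" if e: "x powr (p - 1) * y = m"
    proof -
      have "(1 - 1 / p) * ln (x powr p / m) = (1 - 1 / p) * (x powr p / m - 1)"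
        "(1 / p) * ln (y powr p / m) = (1 / p) * (y powr p / m - 1)"
        using a1 a2 sum1 lns e by (simp_all only: diff_self)
      hence lnx: "ln (x powr p / m) = x powr p / m - 1" and lny: "ln (y powr p / m) = y powr p / m - 1"
        using q p by auto
      have "x powr p / m = 1" by (rule ln_eq_minus_one[OF _ lnx]) (use x m in simp)
      moreover have "y powr p / m = 1" by (rule ln_eq_minus_one[OF _ lny]) (use y m in simp)
      ultimately have "x powr p = y powr p" using m by (simp add: field_simps)
      hence "(x powr p) powr (1 / p) = (y powr p) powr (1 / p)" by simp
      thus "x = y" using p x y by (simp add: powr_powr)
    qed
    with le show ?thesis unfolding m_def by auto
  qed
  thus "x powr (p - 1) * y \<le> (1 - 1 / p) * x powr p + y powr p / p"
    and "x powr (p - 1) * y = (1 - 1 / p) * x powr p + y powr p / p \<Longrightarrow> x = y" by auto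
qed

lemma abs_diff_powr_le:
  fixes a b p :: real
  assumes "0 < p"
  shows "\<bar>a - b\<bar> powr p \<le> 2 powr p * (\<bar>a\<bar> powr p + \<bar>b\<bar> powr p)"
proof -
  have "\<bar>a - b\<bar> powr p \<le> (2 * max \<bar>a\<bar> \<bar>b\<bar>) powr p"
    using assms by (intro powr_mono2) auto
  also have "\<dots> = 2 powr p * (max \<bar>a\<bar> \<bar>b\<bar>) powr p" by (simp add: powr_mult)
  also have "\<dots> \<le> 2 powr p * (\<bar>a\<bar> powr p + \<bar>b\<bar> powr p)"
    by (intro mult_left_mono) (auto simp: max_def)
  finally show ?thesis .
qed

lemma integrable_powr_diff:
  fixes f g :: "'a \<Rightarrow> real"
  assumes "0 < p" and [measurable]: "f \<in> borel_measurable M" "g \<in> borel_measurable M"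
    and "integrable M (\<lambda>x. \<bar>f x\<bar> powr p)" "integrable M (\<lambda>x. \<bar>g x\<bar> powr p)"
  shows "integrable M (\<lambda>x. \<bar>f x - g x\<bar> powr p)"
proof (rule Bochner_Integration.integrable_bound)
  show "integrable M (\<lambda>x. 2 powr p * (\<bar>f x\<bar> powr p + \<bar>g x\<bar> powr p))"
    using assms by auto
  show "AE x in M. norm (\<bar>f x - g x\<bar> powr p) \<le> norm (2 powr p * (\<bar>f x\<bar> powr p + \<bar>g x\<bar> powr p))"
    using abs_diff_powr_le[OF assms(1)] by simp
qed simp

lemma integrable_powr_mult:
  fixes f g :: "'a \<Rightarrow> real"
  assumes "1 < p" and [measurable]: "f \<in> borel_measurable M" "g \<in> borel_measurable M"
    and "integrable M (\<lambda>x. \<bar>f x\<bar> powr p)" "integrable M (\<lambda>x. \<bar>g x\<bar> powr p)"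
  shows "integrable M (\<lambda>x. \<bar>f x\<bar> powr (p - 1) * \<bar>g x\<bar>)"
proof (rule Bochner_Integration.integrable_bound)
  show "integrable M (\<lambda>x. (1 - 1 / p) * \<bar>f x\<bar> powr p + \<bar>g x\<bar> powr p / p)"
    using assms by auto
  have "norm (\<bar>f x\<bar> powr (p - 1) * \<bar>g x\<bar>) \<le>
      norm ((1 - 1 / p) * \<bar>f x\<bar> powr p + \<bar>g x\<bar> powr p / p)" for x
    using Young_powr(1)[OF assms(1), of "\<bar>f x\<bar>" "\<bar>g x\<bar>"] by (simp add: abs_mult)
  thus "AE x in M. norm (\<bar>f x\<bar> powr (p - 1) * \<bar>g x\<bar>) \<le>
      norm ((1 - 1 / p) * \<bar>f x\<bar> powr p + \<bar>g x\<bar> powr p / p)" by simp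
qed simp

text \<open>Young's inequality for |f| and |g| / c is integrated; the integral of the gap is
  \<open>F - ?I / c\<close>. If it is 0, the nonnegative gap vanishes almost everywhere and the
  equality case of Young's inequality gives |f| = |g| / c. The exponents p - 1 and 1 are those of
  the pairing.\<close>

lemma Hoelder_powr:
  fixes f g :: "'a \<Rightarrow> real"
  assumes p: "1 < p" and [measurable]: "f \<in> borel_measurable M" "g \<in> borel_measurable M"
    and f: "integrable M (\<lambda>x. \<bar>f x\<bar> powr p)" and g: "integrable M (\<lambda>x. \<bar>g x\<bar> powr p)"
  defines "F \<equiv> (LINT x|M. \<bar>f x\<bar> powr p)" and "G \<equiv> (LINT x|M. \<bar>g x\<bar> powr p)"
  shows "(LINT x|M. \<bar>f x\<bar> powr (p - 1) * \<bar>g x\<bar>) \<le> F powr (1 - 1 / p) * G powr (1 / p)"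
    and "(LINT x|M. \<bar>f x\<bar> powr (p - 1) * \<bar>g x\<bar>) = F powr (1 - 1 / p) * G powr (1 / p) \<Longrightarrow>
      0 < F \<Longrightarrow> 0 < G \<Longrightarrow> AE x in M. \<bar>g x\<bar> = (G / F) powr (1 / p) * \<bar>f x\<bar>"
proof -
  let ?I = "LINT x|M. \<bar>f x\<bar> powr (p - 1) * \<bar>g x\<bar>"
  have nn: "0 \<le> F" "0 \<le> G" unfolding F_def G_def by simp_all
  have fg: "integrable M (\<lambda>x. \<bar>f x\<bar> powr (p - 1) * \<bar>g x\<bar>)"
    by (rule integrable_powr_mult) (use assms in auto)
  have main: "?I \<le> F powr (1 - 1 / p) * G powr (1 / p) \<and> (?I = F powr (1 - 1 / p) * G powr (1 / p) \<longrightarrow>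
      (AE x in M. \<bar>g x\<bar> = (G / F) powr (1 / p) * \<bar>f x\<bar>))" if "0 < F" "0 < G"
  proof -
    \<comment> \<open>The scaling for which |f| and |g| / c have the same p-th power integral; any
      other one would lose the sharp constant.\<close>
    define c where "c = (G / F) powr (1 / p)"
    have c: "0 < c" unfolding c_def using that by simp
    have cp: "c powr p = G / F" unfolding c_def using that p by (simp add: powr_powr)
    have prod: "F powr (1 - 1 / p) * G powr (1 / p) = c * F"
      unfolding c_def using that p by (simp add: powr_divide powr_diff)
    define h where "h x = (1 - 1 / p) * \<bar>f x\<bar> powr p + (\<bar>g x\<bar> / c) powr p / p
        - \<bar>f x\<bar> powr (p - 1) * (\<bar>g x\<bar> / c)" for x
    have h0: "0 \<le> h x" for x
      unfolding h_def using Young_powr(1)[OF p, of "\<bar>f x\<bar>" "\<bar>g x\<bar> / c"] c by simp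
    have hh: "h = (\<lambda>x. (1 - 1 / p) * \<bar>f x\<bar> powr p + \<bar>g x\<bar> powr p * (F / (G * p))
        - (\<bar>f x\<bar> powr (p - 1) * \<bar>g x\<bar>) / c)"
      unfolding h_def using c cp by (auto simp: powr_divide fun_eq_iff)
    have hint: "integrable M h"
      unfolding hh using fg f g by auto
    have "integral\<^sup>L M h = (1 - 1 / p) * F + G * (F / (G * p)) - ?I / c"
      unfolding hh F_def G_def using fg f g by simp
    also have "G * (F / (G * p)) = F / p" using that by simp
    finally have H: "integral\<^sup>L M h = F - ?I / c" by (simp add: algebra_simps)
    have "0 \<le> integral\<^sup>L M h" using h0 by simp
    hence le: "?I \<le> c * F" using H c by (simp add: field_simps)
    have "AE x in M. \<bar>g x\<bar> = c * \<bar>f x\<bar>" if "?I = c * F"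
    proof -
      have "integral\<^sup>L M h = 0" using H that c by simp
      hence "AE x in M. h x = 0"
        using integral_nonneg_eq_0_iff_AE[OF hint] h0 by simp
      thus ?thesis
      proof eventually_elim
        case (elim x)
        hence "\<bar>f x\<bar> = \<bar>g x\<bar> / c"
          using Young_powr(2)[OF p, of "\<bar>f x\<bar>" "\<bar>g x\<bar> / c"] c unfolding h_def by simp
        thus ?case using c by (simp add: field_simps)
      qed
    qed
    with le show ?thesis unfolding prod c_def by blast
  qed
  \<comment> \<open>In the degenerate cases one of the functions is 0 almost everywhere, so the
    left-hand side vanishes.\<close>
  have z: "?I = 0" if "F = 0 \<or> G = 0"
  proof -
    have "AE x in M. \<bar>f x\<bar> powr (p - 1) * \<bar>g x\<bar> = 0"
      using that
    proof
      assume "F = 0"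
      hence "AE x in M. \<bar>f x\<bar> powr p = 0"
        unfolding F_def using integral_nonneg_eq_0_iff_AE[OF f] by simp
      thus ?thesis by eventually_elim auto
    next
      assume "G = 0"
      hence "AE x in M. \<bar>g x\<bar> powr p = 0"
        unfolding G_def using integral_nonneg_eq_0_iff_AE[OF g] by simp
      thus ?thesis by eventually_elim auto
    qed
    thus ?thesis by (rule integral_eq_zero_AE)
  qed
  show "?I \<le> F powr (1 - 1 / p) * G powr (1 / p)"
    using main z nn by (cases "0 < F \<and> 0 < G") auto
  show "?I = F powr (1 - 1 / p) * G powr (1 / p) \<Longrightarrow>
      0 < F \<Longrightarrow> 0 < G \<Longrightarrow> AE x in M. \<bar>g x\<bar> = (G / F) powr (1 / p) * \<bar>f x\<bar>"
    using main by blast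
qed

text \<open>The convergence of the integrals to a real number bounds the lower limit in Fatou's
  lemma for nonnegative integrals, and this makes the limit function integrable.\<close>

lemma Fatou_integral:
  fixes f :: "nat \<Rightarrow> 'a \<Rightarrow> real"
  assumes f: "\<And>n. integrable M (f n)" and nn: "\<And>n. AE x in M. 0 \<le> f n x"
    and g [measurable]: "g \<in> borel_measurable M" and lim: "AE x in M. (\<lambda>n. f n x) \<longlonglongrightarrow> g x"
    and I: "(\<lambda>n. integral\<^sup>L M (f n)) \<longlonglongrightarrow> c"
  shows "integrable M g" and "integral\<^sup>L M g \<le> c"
proof -
  have [measurable]: "f n \<in> borel_measurable M" for n using f by auto
  have nnI: "(\<integral>\<^sup>+x. ennreal (f n x) \<partial>M) = ennreal (integral\<^sup>L M (f n))" for n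
    using nn_integral_eq_integral[OF f nn] .
  have "0 \<le> integral\<^sup>L M (f n)" for n using nn by (rule integral_nonneg_AE)
  hence c: "0 \<le> c" using I by (simp add: LIMSEQ_le_const)
  have "AE x in M. \<forall>n. 0 \<le> f n x" using nn by (simp add: AE_all_countable)
  with lim have g0: "AE x in M. 0 \<le> g x" by eventually_elim (auto intro: LIMSEQ_le_const)
  have "(\<integral>\<^sup>+x. ennreal (g x) \<partial>M) = (\<integral>\<^sup>+x. liminf (\<lambda>n. ennreal (f n x)) \<partial>M)"
  proof (rule nn_integral_cong_AE)
    show "AE x in M. ennreal (g x) = liminf (\<lambda>n. ennreal (f n x))" using lim
    proof eventually_elim
      case (elim x)
      hence "(\<lambda>n. ennreal (f n x)) \<longlonglongrightarrow> ennreal (g x)" by (rule tendsto_ennrealI)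
      thus ?case using lim_imp_Liminf by force
    qed
  qed
  also have "\<dots> \<le> liminf (\<lambda>n. \<integral>\<^sup>+x. ennreal (f n x) \<partial>M)" by (rule nn_integral_liminf) measurable
  also have "\<dots> = ennreal c"
    unfolding nnI by (intro lim_imp_Liminf tendsto_ennrealI I) simp
  finally have le: "(\<integral>\<^sup>+x. ennreal (g x) \<partial>M) \<le> ennreal c" .
  show gi: "integrable M g"
    by (rule integrableI_nonneg) (use g0 le in \<open>auto simp: less_top[symmetric] top_unique\<close>)
  show "integral\<^sup>L M g \<le> c"
    using nn_integral_eq_integral[OF gi g0] le c by simp
qed

subsection \<open>Test functions\<close>

lemma C_upto_imp_continuous: "C_upto k f \<Longrightarrow> continuous_on UNIV f"
  by (cases k) (auto simp: continuous_on_eq_continuous_at differentiable_imp_continuous_within)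

text \<open>Product and chain rule leave undifferentiated factors behind, for which the inductions
  below have to step down one order of smoothness.\<close>

lemma C_upto_Suc_imp: "C_upto (Suc k) f \<Longrightarrow> C_upto k f"
proof (induction k arbitrary: f)
  case 0
  thus ?case using C_upto_imp_continuous by (auto simp del: C_upto.simps(2))
next
  case (Suc k)
  thus ?case by (metis C_upto.simps(2))
qed

lemma C_upto_const: "C_upto k (\<lambda>x. c)"
  by (induction k arbitrary: c) (auto simp: frechet_derivative_const)

lemma C_upto_add:
  assumes "C_upto k f" "C_upto k g" shows "C_upto k (\<lambda>x. f x + g x)"
  using assms
proof (induction k arbitrary: f g)
  case (Suc k)
  have "frechet_derivative (\<lambda>x. f x + g x) (at x)
      = (\<lambda>b. frechet_derivative f (at x) b + frechet_derivative g (at x) b)" for x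
    by (rule frechet_derivative_at[symmetric], rule has_derivative_add)
      (use Suc.prems in \<open>auto simp: frechet_derivative_works[symmetric]\<close>)
  with Suc show ?case by simp
qed (auto intro: continuous_intros)

lemma C_upto_mult:
  assumes "C_upto k f" "C_upto k g" shows "C_upto k (\<lambda>x. f x * g x)"
  using assms
proof (induction k arbitrary: f g)
  case (Suc k)
  have "frechet_derivative (\<lambda>x. f x * g x) (at x)
      = (\<lambda>b. f x * frechet_derivative g (at x) b + frechet_derivative f (at x) b * g x)" for x
    by (rule frechet_derivative_at[symmetric], rule has_derivative_mult)
      (use Suc.prems in \<open>auto simp: frechet_derivative_works[symmetric]\<close>)
  moreover have "C_upto k f" "C_upto k g" using Suc.prems by (auto dest: C_upto_Suc_imp simp del: C_upto.simps)
  ultimately show ?case using Suc by (auto intro!: C_upto_add)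
qed (auto intro: continuous_intros)

text \<open>Differentiation lowers the exponent by 1, so the induction leaves \<open>a\<close>
  arbitrary. The case a = 1/2 provides smooth square roots of positive functions.\<close>

lemma C_upto_powr:
  assumes "C_upto k f" "\<And>x. 0 < f x" shows "C_upto k (\<lambda>x. f x powr a)"
  using assms
proof (induction k arbitrary: a)
  case 0
  thus ?case by (auto intro!: continuous_intros simp: less_imp_neq[THEN not_sym])
next
  case (Suc k)
  have d: "((\<lambda>x. f x powr a) has_derivative (\<lambda>b. a * f x powr (a - 1) * frechet_derivative f (at x) b)) (at x)" for x
  proof -
    have "(f has_derivative frechet_derivative f (at x)) (at x)"
      using Suc.prems by (simp add: frechet_derivative_works[symmetric])
    moreover have "((\<lambda>t. t powr a) has_derivative (\<lambda>h. a * f x powr (a - 1) * h)) (at (f x))"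
      using has_real_derivative_powr[OF Suc.prems(2), of a x]
      unfolding has_field_derivative_def by simp
    ultimately show ?thesis
      using has_derivative_compose[of f _ x UNIV "\<lambda>t. t powr a"] by simp
  qed
  have fd: "frechet_derivative (\<lambda>x. f x powr a) (at x)
      = (\<lambda>b. a * f x powr (a - 1) * frechet_derivative f (at x) b)" for x
    by (rule frechet_derivative_at[symmetric], rule d)
  have "C_upto k (\<lambda>x. f x powr (a - 1))" using Suc C_upto_Suc_imp by blast
  moreover have "\<forall>b\<in>Basis. C_upto k (\<lambda>x. frechet_derivative f (at x) b)" using Suc.prems by simp
  ultimately have "\<forall>b\<in>Basis. C_upto k (\<lambda>x. frechet_derivative (\<lambda>x. f x powr a) (at x) b)"
    unfolding fd by (auto intro!: C_upto_mult C_upto_const)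
  moreover have "(\<lambda>x. f x powr a) differentiable (at x)" for x
    using d by (auto simp: differentiable_def)
  ultimately show ?case by simp
qed

lemma test_functions_cmult:
  "\<phi> \<in> test_functions \<Omega> \<Longrightarrow> (\<lambda>x. c * \<phi> x) \<in> test_functions \<Omega>"
  unfolding test_functions_def smooth_def by (auto intro!: C_upto_mult C_upto_const) 

lemma test_functions_diff:
  assumes "\<phi> \<in> test_functions \<Omega>" "\<psi> \<in> test_functions \<Omega>"
  shows "(\<lambda>x. \<phi> x - \<psi> x) \<in> test_functions \<Omega>"
proof -
  obtain K L where "compact K" "K \<subseteq> \<Omega>" "\<forall>x. x \<notin> K \<longrightarrow> \<phi> x = 0"
    "compact L" "L \<subseteq> \<Omega>" "\<forall>x. x \<notin> L \<longrightarrow> \<psi> x = 0"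
    using assms unfolding test_functions_def by blast
  hence "compact (K \<union> L) \<and> K \<union> L \<subseteq> \<Omega> \<and> (\<forall>x. x \<notin> K \<union> L \<longrightarrow> \<phi> x - \<psi> x = 0)" by auto
  moreover have "C_upto k (\<lambda>x. \<phi> x + (-1) * \<psi> x)" for k
    using assms unfolding test_functions_def smooth_def
    by (intro C_upto_add C_upto_mult C_upto_const) auto
  ultimately show ?thesis unfolding test_functions_def smooth_def by auto
qed

text \<open>A smooth approximation of |t|. For \<epsilon> > 0 the subtraction of \<epsilon> gives
  the value 0 at t = 0, so that composition with a test function does not enlarge its
  support.\<close>

definition smooth_abs :: "real \<Rightarrow> real \<Rightarrow> real" where
  "smooth_abs \<epsilon> t = sqrt (\<epsilon>\<^sup>2 + t\<^sup>2) - \<epsilon>"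

lemma smooth_abs_test_function:
  assumes "\<phi> \<in> test_functions \<Omega>" "0 < \<epsilon>"
  shows "(\<lambda>x. smooth_abs \<epsilon> (\<phi> x)) \<in> test_functions \<Omega>"
proof -
  have "C_upto k (\<lambda>x. (\<epsilon>\<^sup>2 + \<phi> x * \<phi> x) powr (1 / 2) + (- \<epsilon>))" for k
    using assms unfolding test_functions_def smooth_def
    by (intro C_upto_add C_upto_mult C_upto_const C_upto_powr) (auto intro: add_pos_nonneg)
  hence "smooth (\<lambda>x. smooth_abs \<epsilon> (\<phi> x))"
    unfolding smooth_def smooth_abs_def by (simp add: powr_half_sqrt power2_eq_square)
  thus ?thesis using assms unfolding test_functions_def smooth_abs_def by auto
qed

lemma smooth_abs_nonneg: "0 < \<epsilon> \<Longrightarrow> 0 \<le> smooth_abs \<epsilon> t"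
  unfolding smooth_abs_def by (simp add: real_le_rsqrt)

text \<open>The square root is the norm of the vector (\<epsilon>, t) in the plane, which reduces
  the claim to the reverse triangle inequality.\<close>

lemma smooth_abs_lipschitz: 
  assumes "0 < \<epsilon>" shows "\<bar>smooth_abs \<epsilon> a - smooth_abs \<epsilon> b\<bar> \<le> \<bar>a - b\<bar>"
proof -
  let ?n = "\<lambda>t. norm (\<epsilon>, t::real)"
  have n: "?n t = sqrt (\<epsilon>\<^sup>2 + t\<^sup>2)" for t by (simp add: norm_Pair)
  have "\<bar>?n a - ?n b\<bar> \<le> norm ((\<epsilon>, a) - (\<epsilon>, b))" by (rule norm_triangle_ineq3)
  thus ?thesis unfolding n smooth_abs_def by simp
qed

lemma smooth_abs_tendsto:
  assumes "f \<longlonglongrightarrow> l" "e \<longlonglongrightarrow> 0"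
  shows "(\<lambda>n. smooth_abs (e n) (f n)) \<longlonglongrightarrow> \<bar>l\<bar>"
proof -
  have "(\<lambda>n. smooth_abs (e n) (f n)) \<longlonglongrightarrow> sqrt (0\<^sup>2 + l\<^sup>2) - 0"
    unfolding smooth_abs_def by (intro tendsto_intros assms)
  thus ?thesis by simp
qed

subsection \<open>Test functions have finite Gagliardo energy\<close>

text \<open>The function is dominated by the series of \<open>c k\<close> times the indicators of
  the balls of radius \<open>r k\<close>, whose integral is the unit ball volume times the given
  series. It is meant for dyadic annuli, where passing from an annulus to the full ball costs a
  constant factor.\<close>

lemma nn_integral_finite_by_balls:
  fixes f :: "'a::euclidean_space \<Rightarrow> ennreal" and c r :: "nat \<Rightarrow> real"
  assumes f: "\<And>h. f h = 0 \<or> (\<exists>k. norm h \<le> r k \<and> f h \<le> ennreal (c k))"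
    and "\<And>k. 0 \<le> r k" "\<And>k. 0 \<le> c k" and sum: "summable (\<lambda>k. c k * r k ^ DIM('a))"
  shows "(\<integral>\<^sup>+h. f h \<partial>lborel) < \<infinity>"
proof -
  let ?V = "unit_ball_vol (real DIM('a))"
  have [measurable]: "cball (0::'a) t \<in> sets borel" for t by (simp add: borel_closed)
  have le: "f h \<le> (\<Sum>k. ennreal (c k) * indicator (cball 0 (r k)) h)" for h
  proof (cases "f h = 0")
    case False
    then obtain k where "norm h \<le> r k" "f h \<le> ennreal (c k)" using f by blast
    hence "f h \<le> (\<Sum>j\<in>{k}. ennreal (c j) * indicator (cball 0 (r j)) h)" by simp
    also have "\<dots> \<le> (\<Sum>k. ennreal (c k) * indicator (cball 0 (r k)) h)"
      by (rule sum_le_suminf) auto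
    finally show ?thesis .
  qed simp
  have "(\<integral>\<^sup>+h. f h \<partial>lborel) \<le> (\<integral>\<^sup>+h. (\<Sum>k. ennreal (c k) * indicator (cball (0::'a) (r k)) h) \<partial>lborel)"
    by (intro nn_integral_mono le)
  also have "\<dots> = (\<Sum>k. \<integral>\<^sup>+h. ennreal (c k) * indicator (cball (0::'a) (r k)) h \<partial>lborel)"
    by (rule nn_integral_suminf) measurable
  also have "\<dots> = (\<Sum>k. ennreal (?V * (c k * r k ^ DIM('a))))"
    using assms by (simp add: nn_integral_cmult_indicator emeasure_cball ennreal_mult'[symmetric] mult_ac)
  also have "\<dots> = ennreal (\<Sum>k. ?V * (c k * r k ^ DIM('a)))"
    using assms by (intro suminf_ennreal2 summable_mult) auto
  finally show ?thesis by (metis ennreal_less_top infinity_ennreal_def le_less_trans)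
qed

lemma ex_dyadic:
  fixes t :: real assumes "1 \<le> t"
  obtains k where "2 ^ k \<le> t" "t < 2 ^ Suc k"
proof -
  define n where "n = (LEAST n. t < 2 ^ n)"
  obtain m where "t < 2 ^ m" using real_arch_pow[of 2 t] by auto
  hence n: "t < 2 ^ n" unfolding n_def by (rule LeastI)
  with assms obtain k where k: "n = Suc k" by (cases n) auto
  have "\<not> t < 2 ^ k" using not_less_Least[of k "\<lambda>n. t < 2 ^ n"] k unfolding n_def by auto
  with n k that[of k] show thesis by simp
qed

lemma power_powr_commute:
  fixes a e :: real
  assumes "0 < a"
  shows "(a ^ k) powr e = (a powr e) ^ k"
proof -
  have "(a ^ k) powr e = (a powr real k) powr e" using assms by (simp add: powr_realpow)
  also have "\<dots> = a powr (real k * e)" by (rule powr_powr)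
  also have "\<dots> = (a powr e) ^ k" using assms by (simp add: powr_power)
  finally show ?thesis .
qed

text \<open>For (1/2)^(k+1) < |h| \<le> (1/2)^k the integrand is at most 2^N 2^(-e k) 2^(k N). The
  volume of the ball cancels 2^(k N) and leaves a geometric series of ratio 2^(-e).\<close>

lemma nn_integral_norm_powr_near_zero:
  assumes "0 < e"
  shows "(\<integral>\<^sup>+h. ennreal (norm (h::'a::euclidean_space) powr (e - real DIM('a))) * indicator (cball 0 1) h \<partial>lborel) < \<infinity>"
proof (rule nn_integral_finite_by_balls[where r = "\<lambda>k. (1 / 2) ^ k" and c = "\<lambda>k. 2 ^ DIM('a) * (2 powr (- e)) ^ k * (2 ^ k) ^ DIM('a)"])
  let ?N = "DIM('a)"
  fix h :: 'a
  show "ennreal (norm h powr (e - real ?N)) * indicator (cball 0 1) h = 0 \<or>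
    (\<exists>k. norm h \<le> (1 / 2) ^ k \<and> ennreal (norm h powr (e - real ?N)) * indicator (cball 0 1) h
       \<le> ennreal (2 ^ ?N * (2 powr (- e)) ^ k * (2 ^ k) ^ ?N))"
  \<comment> \<open>At h = 0 the convention \<open>0 powr a = 0\<close> removes the singularity, and
    beyond the unit ball the indicator is 0.\<close>
  proof (cases "h = 0 \<or> 1 < norm h")
    case False
    hence h: "0 < norm h" "norm h \<le> 1" by auto
    then obtain k where k: "2 ^ k \<le> 1 / norm h" "1 / norm h < 2 ^ Suc k"
      using ex_dyadic[of "1 / norm h"] by auto
    have le: "norm h \<le> (1 / 2) ^ k" using k h by (simp add: field_simps)
    have "norm h powr e \<le> ((1 / 2) ^ k) powr e" using le assms by (intro powr_mono2) auto
    also have "\<dots> = (2 powr (- e)) ^ k"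
      by (simp add: power_powr_commute powr_divide powr_minus inverse_eq_divide)
    finally have 1: "norm h powr e \<le> (2 powr (- e)) ^ k" .
    have "norm h powr (- real ?N) = (1 / norm h) ^ ?N"
      using h powr_realpow[of "norm h" ?N] by (simp add: powr_minus power_one_over inverse_eq_divide)
    also have "\<dots> \<le> (2 ^ Suc k) ^ ?N" using k h by (intro power_mono) auto
    also have "\<dots> = 2 ^ ?N * (2 ^ k) ^ ?N" by (simp add: power_mult_distrib)
    finally have 2: "norm h powr (- real ?N) \<le> 2 ^ ?N * (2 ^ k) ^ ?N" .
    have "norm h powr (e - real ?N) = norm h powr e * norm h powr (- real ?N)"
      by (simp add: powr_add[symmetric])
    also have "\<dots> \<le> (2 powr (- e)) ^ k * (2 ^ ?N * (2 ^ k) ^ ?N)"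
      by (rule mult_mono[OF 1 2]) auto
    finally show ?thesis using le h by (auto intro!: exI[of _ k] ennreal_leI simp: mult_ac)
  qed auto
  have "(\<lambda>k. 2 ^ ?N * (2 powr (- e)) ^ k * (2 ^ k) ^ ?N * ((1 / 2) ^ k) ^ ?N) = (\<lambda>k. 2 ^ ?N * (2 powr (- e)) ^ k :: real)"
    by (simp add: fun_eq_iff power_mult_distrib[symmetric])
  moreover have "summable (\<lambda>k. 2 ^ ?N * (2 powr (- e)) ^ k :: real)"
    using assms by (intro summable_mult summable_geometric) (simp add: powr_less_one)
  ultimately show "summable (\<lambda>k. 2 ^ ?N * (2 powr (- e)) ^ k * (2 ^ k) ^ ?N * ((1 / 2) ^ k) ^ ?N :: real)" by simp
qed auto

text \<open>Here the annuli 2^k \<le> |h| < 2^(k+1) grow outwards inside balls of radius 2^(k+1);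
  the decay beyond the power -N again leaves a geometric series of ratio 2^(-e).\<close>

lemma nn_integral_norm_powr_near_infinity:
  assumes "0 < e"
  shows "(\<integral>\<^sup>+h. ennreal (norm (h::'a::euclidean_space) powr (- e - real DIM('a))) * indicator (- cball 0 1) h \<partial>lborel) < \<infinity>"
proof (rule nn_integral_finite_by_balls[where r = "\<lambda>k. 2 ^ Suc k" and c = "\<lambda>k. (2 powr (- e)) ^ k * (1 / 2 ^ k) ^ DIM('a)"])
  let ?N = "DIM('a)"
  fix h :: 'a
  show "ennreal (norm h powr (- e - real ?N)) * indicator (- cball 0 1) h = 0 \<or>
    (\<exists>k. norm h \<le> 2 ^ Suc k \<and> ennreal (norm h powr (- e - real ?N)) * indicator (- cball 0 1) h
       \<le> ennreal ((2 powr (- e)) ^ k * (1 / 2 ^ k) ^ ?N))"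
  proof (cases "1 < norm h")
    case True
    then obtain k where k: "2 ^ k \<le> norm h" "norm h < 2 ^ Suc k"
      using ex_dyadic[of "norm h"] by auto
    have "norm h powr (- e) \<le> (2 ^ k) powr (- e)" using k assms by (intro powr_mono2') auto
    also have "\<dots> = (2 powr (- e)) ^ k"
      by (simp add: power_powr_commute)
    finally have 1: "norm h powr (- e) \<le> (2 powr (- e)) ^ k" .
    have "norm h powr (- real ?N) = (1 / norm h) ^ ?N"
    proof -
      have "0 < norm h" using True by linarith
      thus ?thesis by (simp only: powr_minus powr_realpow power_one_over inverse_eq_divide)
    qed
    also have "\<dots> \<le> (1 / 2 ^ k) ^ ?N" using k by (intro power_mono frac_le) auto
    finally have 2: "norm h powr (- real ?N) \<le> (1 / 2 ^ k) ^ ?N" .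
    have "norm h powr (- e - real ?N) = norm h powr (- e) * norm h powr (- real ?N)"
      by (simp add: powr_add[symmetric])
    also have "\<dots> \<le> (2 powr (- e)) ^ k * (1 / 2 ^ k) ^ ?N"
      by (rule mult_mono[OF 1 2]) auto
    finally show ?thesis using k True by (auto intro!: exI[of _ k] ennreal_leI simp: less_imp_le)
  qed auto
  have "(\<lambda>k. (2 powr (- e)) ^ k * (1 / 2 ^ k) ^ ?N * (2 ^ Suc k) ^ ?N) = (\<lambda>k. 2 ^ ?N * (2 powr (- e)) ^ k :: real)"
    by (simp add: fun_eq_iff power_mult_distrib power_divide)
  moreover have "summable (\<lambda>k. 2 ^ ?N * (2 powr (- e)) ^ k :: real)"
    using assms by (intro summable_mult summable_geometric) (simp add: powr_less_one)
  ultimately show "summable (\<lambda>k. (2 powr (- e)) ^ k * (1 / 2 ^ k) ^ ?N * (2 ^ Suc k) ^ ?N :: real)" by simp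
qed auto

lemma nn_integral_lborel_diff:
  fixes f :: "'a::euclidean_space \<Rightarrow> ennreal"
  assumes [measurable]: "f \<in> borel_measurable borel"
  shows "(\<integral>\<^sup>+y. f (y - x) \<partial>lborel) = (\<integral>\<^sup>+y. f y \<partial>lborel)"
proof -
  have "(\<integral>\<^sup>+y. f y \<partial>lborel) = (\<integral>\<^sup>+y. f y \<partial>distr lborel borel ((+) (- x)))"
    by (simp add: lborel_distr_plus)
  also have "\<dots> = (\<integral>\<^sup>+y. f (y - x) \<partial>lborel)" by (subst nn_integral_distr) auto
  finally show ?thesis by simp
qed

lemma compact_support_bounded:
  fixes g :: "'a::euclidean_space \<Rightarrow> real"
  assumes "continuous_on UNIV g" "compact K" "\<And>x. x \<notin> K \<Longrightarrow> g x = 0"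
  obtains M where "0 \<le> M" "\<And>x. \<bar>g x\<bar> \<le> M"
proof -
  have "bounded (g ` K)"
    using assms by (intro compact_imp_bounded compact_continuous_image) (auto intro: continuous_on_subset)
  then obtain M where M: "\<And>x. x \<in> K \<Longrightarrow> \<bar>g x\<bar> \<le> M" unfolding bounded_iff by auto
  have "\<bar>g x\<bar> \<le> max M 0" for x using M[of x] assms(3)[of x] by (cases "x \<in> K") auto
  thus thesis using that[of "max M 0"] by auto
qed

lemma test_function_bounded:
  assumes "\<phi> \<in> test_functions \<Omega>"
  obtains M where "0 \<le> M" "\<And>x. \<bar>\<phi> x\<bar> \<le> M"
proof -
  obtain K where "compact K" "\<forall>x. x \<notin> K \<longrightarrow> \<phi> x = 0" and s: "smooth \<phi>"
    using assms unfolding test_functions_def by blast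
  moreover have "continuous_on UNIV \<phi>" using s C_upto_imp_continuous unfolding smooth_def by blast
  ultimately show thesis using compact_support_bounded[of \<phi> K] that by blast
qed

text \<open>The partial derivatives are continuous and vanish outside the compact set
  \<open>K\<close>, hence are bounded; the mean value inequality on the whole space does the
  rest.\<close>

lemma test_function_lipschitz:
  fixes \<phi> :: "'a::euclidean_space \<Rightarrow> real"
  assumes "\<phi> \<in> test_functions \<Omega>"
  obtains L where "0 \<le> L" "\<And>x y. \<bar>\<phi> x - \<phi> y\<bar> \<le> L * norm (x - y)"
proof -
  obtain K where K: "compact K" "\<And>x. x \<notin> K \<Longrightarrow> \<phi> x = 0" and s: "smooth \<phi>"
    using assms unfolding test_functions_def by blast
  let ?D = "\<lambda>x. frechet_derivative \<phi> (at x)"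
  have C1: "C_upto (Suc 0) \<phi>" using s unfolding smooth_def by blast
  have der: "(\<phi> has_derivative ?D x) (at x)" for x
    using C1 by (simp add: frechet_derivative_works[symmetric])
  \<comment> \<open>The complement of \<open>K\<close> is open and \<phi> is 0 on it, so the
    derivative vanishes there too.\<close>
  have zero: "?D x = (\<lambda>_. 0)" if "x \<notin> K" for x
  proof (rule frechet_derivative_at[symmetric])
    show "(\<phi> has_derivative (\<lambda>_. 0)) (at x)"
      by (rule has_derivative_transform_within_open[where f = "\<lambda>_. 0" and s = "- K"])
        (use K that in \<open>auto simp: compact_imp_closed open_Compl\<close>)
  qed
  have "\<exists>M. \<forall>x. \<bar>?D x b\<bar> \<le> M" if b: "b \<in> Basis" for b
  proof (rule compact_support_bounded[of "\<lambda>x. ?D x b" K])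
    show "continuous_on UNIV (\<lambda>x. ?D x b)" using C1 b by simp
  qed (use K zero in auto)
  then obtain M where M: "\<And>b x. b \<in> Basis \<Longrightarrow> \<bar>?D x b\<bar> \<le> M b" by metis
  define L where "L = (\<Sum>b\<in>Basis. M b)"
  have Mnn: "0 \<le> M b" if "b \<in> Basis" for b using M[OF that, of 0] by linarith
  have bd: "norm (?D x h) \<le> L * norm h" for x h
  proof -
    have lin: "linear (?D x)" using der has_derivative_linear by blast
    have "?D x h = ?D x (\<Sum>b\<in>Basis. (h \<bullet> b) *\<^sub>R b)" by (simp add: euclidean_representation)
    also have "\<dots> = (\<Sum>b\<in>Basis. (h \<bullet> b) * ?D x b)"
      using lin by (simp add: linear_sum linear_scale)
    finally have "norm (?D x h) \<le> (\<Sum>b\<in>Basis. \<bar>(h \<bullet> b) * ?D x b\<bar>)" by simp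
    also have "\<dots> \<le> (\<Sum>b\<in>Basis. norm h * M b)"
      unfolding abs_mult by (intro sum_mono mult_mono M) (auto simp: Basis_le_norm)
    also have "\<dots> = L * norm h" unfolding L_def by (simp add: sum_distrib_left mult.commute)
    finally show ?thesis .
  qed
  have "norm (\<phi> x - \<phi> y) \<le> L * norm (x - y)" for x y
    by (rule differentiable_bound[where S = UNIV and f' = ?D])
      (use der bd in \<open>auto intro!: onorm_le\<close>)
  moreover have "0 \<le> L" unfolding L_def using Mnn by (auto intro: sum_nonneg)
  ultimately show thesis using that by auto
qed

lemma gagliardo_integrand_measurable [measurable]:
  assumes [measurable]: "u \<in> borel_measurable lborel"
  shows "gagliardo_integrand s p u \<in> borel_measurable (lborel \<Otimes>\<^sub>M lborel)"
  unfolding gagliardo_integrand_def by measurable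

text \<open>A pair contributes only if one of its points lies in the support, which has finite
  measure. It therefore suffices to dominate the integrand by an integrable function
  \<open>j\<close> of x - y. For |x - y| \<le> 1 the Lipschitz bound leaves the power p (1 - s) - N,
  integrable at 0 because s < 1; further away boundedness leaves the power -s p - N, integrable at
  infinity because s > 0.\<close>

lemma test_function_in_frac_sobolev:
  fixes \<phi> :: "'a::euclidean_space \<Rightarrow> real"
  assumes \<phi>: "\<phi> \<in> test_functions \<Omega>" and sp: "0 < s" "s < 1" "0 < p"
  shows "\<phi> \<in> frac_sobolev s p"
proof -
  let ?N = "real DIM('a)"
  obtain K where K: "compact K" "\<And>x. x \<notin> K \<Longrightarrow> \<phi> x = 0" and s: "smooth \<phi>"
    using \<phi> unfolding test_functions_def by blast
  obtain M where M: "0 \<le> M" "\<And>x. \<bar>\<phi> x\<bar> \<le> M" using test_function_bounded[OF \<phi>] by blast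
  obtain L where L: "0 \<le> L" "\<And>x y. \<bar>\<phi> x - \<phi> y\<bar> \<le> L * norm (x - y)" using test_function_lipschitz[OF \<phi>] by blast
  have [measurable]: "\<phi> \<in> borel_measurable borel"
    using s C_upto_imp_continuous unfolding smooth_def by (intro borel_measurable_continuous_onI) blast
  have [measurable]: "K \<in> sets borel" using K by (auto intro: borel_compact)
  have Kfin: "emeasure lborel K < \<infinity>" using K(1) by (intro emeasure_bounded_finite compact_imp_bounded)
  have "integrable lborel (\<lambda>x. \<bar>\<phi> x\<bar> powr p)"
  proof (rule integrableI_bounded_set[where A = K and B = "M powr p"])
    show "AE x in lborel. x \<in> K \<longrightarrow> norm (\<bar>\<phi> x\<bar> powr p) \<le> M powr p"
      using M sp by (auto intro!: powr_mono2)
  qed (use Kfin K in auto)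
  moreover have "integrable (lborel \<Otimes>\<^sub>M lborel) (gagliardo_integrand s p \<phi>)"
  proof (rule integrableI_nonneg)
    define j :: "'a \<Rightarrow> ennreal" where
      "j h = ennreal (L powr p) * (ennreal (norm h powr (p * (1 - s) - ?N)) * indicator (cball 0 1) h)
         + ennreal ((2 * M) powr p) * (ennreal (norm h powr (- (s * p) - ?N)) * indicator (- cball 0 1) h)" for h
    have [measurable]: "cball (0::'a) 1 \<in> sets borel" by (simp add: borel_closed)
    have [measurable]: "j \<in> borel_measurable borel" unfolding j_def by measurable
    define C where "C = (\<integral>\<^sup>+h. j h \<partial>lborel)"
    have C: "C < \<infinity>"
      unfolding C_def j_def using sp
        nn_integral_norm_powr_near_zero[of "p * (1 - s)", where ?'a = 'a]
        nn_integral_norm_powr_near_infinity[of "s * p", where ?'a = 'a]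
      by (subst nn_integral_add; (simp add: nn_integral_cmult ennreal_mult_less_top)?)
    have trans: "(\<integral>\<^sup>+y. j (y - x) \<partial>lborel) = C" for x
      unfolding C_def by (rule nn_integral_lborel_diff) measurable
    have jsym: "j (x - y) = j (y - x)" for x y
      unfolding j_def by (simp add: norm_minus_commute indicator_def)
    have bd: "ennreal (gagliardo_integrand s p \<phi> (x, y)) \<le> j (x - y)" for x y
    proof (cases "x - y \<in> cball 0 1")
      case True
      have "gagliardo_integrand s p \<phi> (x, y) \<le> (L * norm (x - y)) powr p / norm (x - y) powr (?N + s * p)"
        unfolding gagliardo_integrand_def using L sp by (auto intro!: divide_right_mono powr_mono2)
      also have "\<dots> = L powr p * norm (x - y) powr (p * (1 - s) - ?N)"
      proof -
        have e: "p * (1 - s) - ?N = p - (?N + s * p)" by (simp add: algebra_simps)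
        show ?thesis unfolding e powr_diff powr_mult by simp
      qed
      finally show ?thesis using True unfolding j_def
        by (simp add: ennreal_mult'[symmetric] ennreal_leI)
    next
      case False
      have "\<bar>\<phi> x - \<phi> y\<bar> \<le> 2 * M" using M(2)[of x] M(2)[of y] by linarith
      hence "gagliardo_integrand s p \<phi> (x, y) \<le> (2 * M) powr p / norm (x - y) powr (?N + s * p)"
        unfolding gagliardo_integrand_def using sp by (auto intro!: divide_right_mono powr_mono2)
      also have "\<dots> = (2 * M) powr p * norm (x - y) powr (- (s * p) - ?N)"
      proof -
        have e: "- (s * p) - ?N = - (?N + s * p)" by simp
        show ?thesis unfolding e powr_minus by (simp only: divide_inverse)
      qed
      finally show ?thesis using False unfolding j_def
        by (simp add: ennreal_mult'[symmetric] ennreal_leI)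
    qed
    \<comment> \<open>Each of the two terms keeps one variable in \<open>K\<close>; integrating the
      other variable first gives the constant \<open>C\<close> by translation invariance.\<close>
    have bd': "ennreal (gagliardo_integrand s p \<phi> z)
        \<le> indicator K (fst z) * j (snd z - fst z) + indicator K (snd z) * j (fst z - snd z)" for z
    proof (cases "fst z \<in> K \<or> snd z \<in> K")
      case True
      thus ?thesis using bd[of "fst z" "snd z"] jsym[of "fst z" "snd z"]
        by (auto intro: order_trans simp: indicator_def add_increasing add_increasing2)
    next
      case False
      thus ?thesis using K(2) unfolding gagliardo_integrand_def by (auto split: prod.split)
    qed
    have "(\<integral>\<^sup>+z. ennreal (gagliardo_integrand s p \<phi> z) \<partial>(lborel \<Otimes>\<^sub>M lborel))
       \<le> (\<integral>\<^sup>+z. (indicator K (fst z) * j (snd z - fst z) + indicator K (snd z) * j (fst z - snd z)) \<partial>(lborel \<Otimes>\<^sub>M lborel))"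
      by (rule nn_integral_mono, rule bd')
    also have "\<dots> = (\<integral>\<^sup>+z. indicator K (fst z) * j (snd z - fst z) \<partial>(lborel \<Otimes>\<^sub>M lborel))
        + (\<integral>\<^sup>+z. indicator K (snd z) * j (fst z - snd z) \<partial>(lborel \<Otimes>\<^sub>M lborel))"
      by (rule nn_integral_add) measurable
    also have "(\<integral>\<^sup>+z. indicator K (fst z) * j (snd z - fst z) \<partial>(lborel \<Otimes>\<^sub>M lborel))
       = (\<integral>\<^sup>+x. \<integral>\<^sup>+y. indicator K x * j (y - x) \<partial>lborel \<partial>lborel)"
      by (subst lborel.nn_integral_fst[symmetric]) auto
    also have "\<dots> = emeasure lborel K * C"
      by (simp add: nn_integral_cmult trans nn_integral_multc)
    also have "(\<integral>\<^sup>+z. indicator K (snd z) * j (fst z - snd z) \<partial>(lborel \<Otimes>\<^sub>M lborel))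
       = (\<integral>\<^sup>+y. \<integral>\<^sup>+x. indicator K y * j (x - y) \<partial>lborel \<partial>lborel)"
      by (subst lborel_pair.nn_integral_snd[symmetric]) auto
    also have "\<dots> = emeasure lborel K * C"
      by (simp add: nn_integral_cmult trans nn_integral_multc)
    also have "emeasure lborel K * C + emeasure lborel K * C < \<infinity>"
      using Kfin C by (simp add: ennreal_mult_less_top)
    finally show "(\<integral>\<^sup>+z. ennreal (gagliardo_integrand s p \<phi> z) \<partial>(lborel \<Otimes>\<^sub>M lborel)) < \<infinity>" .
  qed (auto simp: gagliardo_integrand_def split: prod.split)
  ultimately show ?thesis unfolding frac_sobolev_def by simp
qed

subsection \<open>Fractional difference quotients\<close>

text \<open>The exponent is chosen so that the p-th power of the modulus is the Gagliardo integrand.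
  As the quotient is linear in \<open>u\<close>, energies become p-th powers of L^p norms over
  pairs, and the pairing falls under \<open>Hoelder_powr\<close>. On the diagonal the value is
  0.\<close>

definition diff_quot :: "real \<Rightarrow> real \<Rightarrow> ('a::euclidean_space \<Rightarrow> real) \<Rightarrow> 'a \<times> 'a \<Rightarrow> real" where
  "diff_quot s p u z = (u (fst z) - u (snd z)) / norm (fst z - snd z) powr ((real DIM('a) + s * p) / p)"

lemma diff_quot_measurable [measurable]:
  assumes [measurable]: "u \<in> borel_measurable borel"
  shows "diff_quot s p u \<in> borel_measurable (borel \<Otimes>\<^sub>M borel)"
  unfolding diff_quot_def by measurable

lemma diff_quot_diff: "diff_quot s p (\<lambda>x. u x - v x) z = diff_quot s p u z - diff_quot s p v z"
  unfolding diff_quot_def by (simp add: diff_divide_distrib[symmetric])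

lemma diff_quot_cmult: "diff_quot s p (\<lambda>x. c * u x) z = c * diff_quot s p u z"
  unfolding diff_quot_def by (simp add: right_diff_distrib[symmetric])

lemma abs_diff_quot_le:
  assumes "\<bar>u (fst z) - u (snd z)\<bar> \<le> \<bar>v (fst z) - v (snd z)\<bar>"
  shows "\<bar>diff_quot s p u z\<bar> \<le> \<bar>diff_quot s p v z\<bar>"
  unfolding diff_quot_def abs_divide using assms by (intro divide_right_mono) auto

lemma gagliardo_integrand_diff_quot:
  assumes "0 < p"
  shows "gagliardo_integrand s p u = (\<lambda>z. \<bar>diff_quot s p u z\<bar> powr p)"
  using assms unfolding gagliardo_integrand_def diff_quot_def
  by (auto simp: fun_eq_iff powr_divide powr_powr)

lemma gagliardo_powr:
  assumes "0 < p"
  shows "gagliardo s p u powr p = (LINT z|(lborel \<Otimes>\<^sub>M lborel). \<bar>diff_quot s p u z\<bar> powr p)"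
proof -
  have "0 \<le> (LINT z|(lborel \<Otimes>\<^sub>M lborel). \<bar>diff_quot s p u z\<bar> powr p)" by simp
  thus ?thesis
    using assms unfolding gagliardo_def gagliardo_integrand_diff_quot[OF assms]
    by (simp add: powr_powr)
qed

lemma frac_p_Laplacian_diff_quot:
  assumes "0 < p"
  shows "frac_p_Laplacian s p u v =
    (LINT z|(lborel \<Otimes>\<^sub>M lborel). \<bar>diff_quot s p u z\<bar> powr (p - 2) * diff_quot s p u z * diff_quot s p v z)"
  unfolding frac_p_Laplacian_def
proof (intro Bochner_Integration.integral_cong refl)
  fix z :: "'a \<times> 'a"
  obtain x y where z: "z = (x, y)" by (cases z)
  let ?k = "real DIM('a) + s * p"
  define m where "m = norm (x - y) powr (?k / p)"
  show "(case z of (x, y) \<Rightarrow> \<bar>u x - u y\<bar> powr (p - 2) * (u x - u y) * (v x - v y) / norm (x - y) powr ?k)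
     = \<bar>diff_quot s p u z\<bar> powr (p - 2) * diff_quot s p u z * diff_quot s p v z"
  proof (cases "x = y")
    case False
    hence m: "0 < m" unfolding m_def by simp
    \<comment> \<open>The kernel splits as m^(p - 2) m m, one part for each of the three factors of
      the numerator.\<close>
    have "norm (x - y) powr ?k = m powr p" using assms unfolding m_def by (simp add: powr_powr)
    also have "\<dots> = m powr (p - 2) * m powr 2" by (simp add: powr_add[symmetric])
    also have "m powr 2 = m * m" using m by (simp add: power2_eq_square)
    finally have k: "norm (x - y) powr ?k = m powr (p - 2) * (m * m)" .
    show ?thesis unfolding z diff_quot_def using m
      by (simp add: k m_def[symmetric] powr_divide)
  qed (simp add: z diff_quot_def)
qed

lemma frac_sobolev_iff:
  assumes "0 < p"
  shows "u \<in> frac_sobolev s p \<longleftrightarrow> u \<in> borel_measurable borel \<and>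
     integrable lborel (\<lambda>x. \<bar>u x\<bar> powr p) \<and>
     integrable (lborel \<Otimes>\<^sub>M lborel) (\<lambda>z. \<bar>diff_quot s p u z\<bar> powr p)"
  unfolding frac_sobolev_def gagliardo_integrand_diff_quot[OF assms] by simp

lemma frac_sobolev_diff:
  assumes "0 < p" "u \<in> frac_sobolev s p" "v \<in> frac_sobolev s p"
  shows "(\<lambda>x. u x - v x) \<in> frac_sobolev s p"
proof -
  have [measurable]: "u \<in> borel_measurable borel" "v \<in> borel_measurable borel"
    using assms frac_sobolev_iff[OF assms(1)] by auto
  show ?thesis
    using assms unfolding frac_sobolev_iff[OF assms(1)] diff_quot_diff
    by (auto intro!: integrable_powr_diff)
qed

lemma frac_sobolev_cmult:
  assumes "0 < p" "u \<in> frac_sobolev s p"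
  shows "(\<lambda>x. c * u x) \<in> frac_sobolev s p"
  using assms(2) unfolding frac_sobolev_iff[OF assms(1)] diff_quot_cmult
  by (auto simp: abs_mult powr_mult)

lemma frac_sobolev_norm_tendsto_0_iff:
  assumes "0 < p"
  shows "(\<lambda>n. frac_sobolev_norm s p (f n)) \<longlonglongrightarrow> 0 \<longleftrightarrow>
     (\<lambda>n. LINT z|(lborel \<Otimes>\<^sub>M lborel). \<bar>diff_quot s p (f n) z\<bar> powr p) \<longlonglongrightarrow> 0 \<and>
     (\<lambda>n. LINT x|lborel. \<bar>f n x\<bar> powr p) \<longlonglongrightarrow> 0"
    (is "_ \<longleftrightarrow> ?G \<longlonglongrightarrow> 0 \<and> ?I \<longlonglongrightarrow> 0")
proof -
  have G: "0 \<le> ?G n" and I: "0 \<le> ?I n" for n by simp_all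
  have norm: "frac_sobolev_norm s p (f n) = (?G n + ?I n) powr (1 / p)" for n
    unfolding frac_sobolev_norm_def gagliardo_powr[OF assms] ..
  show ?thesis
  proof
    assume "(\<lambda>n. frac_sobolev_norm s p (f n)) \<longlonglongrightarrow> 0"
    hence "(\<lambda>n. ((?G n + ?I n) powr (1 / p)) powr p) \<longlonglongrightarrow> 0"
      unfolding norm by (rule tendsto_zero_powrI[where b = p]) (use assms in auto)
    hence s: "(\<lambda>n. ?G n + ?I n) \<longlonglongrightarrow> 0"
      using assms G I by (simp add: powr_powr add_nonneg_nonneg)
    have "?G \<longlonglongrightarrow> 0" by (rule tendsto_sandwich[OF _ _ tendsto_const s]) (use G I in auto)
    moreover have "?I \<longlonglongrightarrow> 0" by (rule tendsto_sandwich[OF _ _ tendsto_const s]) (use G I in auto)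
    ultimately show "?G \<longlonglongrightarrow> 0 \<and> ?I \<longlonglongrightarrow> 0" ..
  next
    assume "?G \<longlonglongrightarrow> 0 \<and> ?I \<longlonglongrightarrow> 0"
    hence "(\<lambda>n. ?G n + ?I n) \<longlonglongrightarrow> 0 + 0" by (intro tendsto_add) auto
    hence "(\<lambda>n. (?G n + ?I n) powr (1 / p)) \<longlonglongrightarrow> 0"
      using assms G I by (intro tendsto_zero_powrI[where b = "1 / p"]) auto
    thus "(\<lambda>n. frac_sobolev_norm s p (f n)) \<longlonglongrightarrow> 0" unfolding norm .
  qed
qed

section \<open>The closure of the test functions\<close>

lemma frac_sobolev0_cmult:
  assumes "0 < p" "u \<in> frac_sobolev0 s p \<Omega>"
  shows "(\<lambda>x. c * u x) \<in> frac_sobolev0 s p \<Omega>"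
proof -
  obtain \<phi> where u: "u \<in> frac_sobolev s p" and \<phi>: "\<And>n. \<phi> n \<in> test_functions \<Omega>"
    and lim: "(\<lambda>n. frac_sobolev_norm s p (\<lambda>x. u x - \<phi> n x)) \<longlonglongrightarrow> 0"
    using assms(2) unfolding frac_sobolev0_def by blast
  have "(\<lambda>n. frac_sobolev_norm s p (\<lambda>x. c * (u x - \<phi> n x))) \<longlonglongrightarrow> 0"
    using lim unfolding frac_sobolev_norm_tendsto_0_iff[OF assms(1)] diff_quot_cmult
    by (auto simp: abs_mult powr_mult intro: tendsto_mult_right_zero)
  hence "(\<lambda>n. frac_sobolev_norm s p (\<lambda>x. c * u x - c * \<phi> n x)) \<longlonglongrightarrow> 0"
    by (simp add: right_diff_distrib)
  thus ?thesis
    using frac_sobolev_cmult[OF assms(1) u] test_functions_cmult[OF \<phi>]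
    unfolding frac_sobolev0_def by (auto intro!: exI[of _ "\<lambda>n x. c * \<phi> n x"])
qed

lemma frac_sobolev0_diff_test_function:
  assumes "0 < s" "s < 1" "0 < p" "u \<in> frac_sobolev0 s p \<Omega>" "\<psi> \<in> test_functions \<Omega>"
  shows "(\<lambda>x. u x - \<psi> x) \<in> frac_sobolev0 s p \<Omega>"
proof -
  obtain \<phi> where u: "u \<in> frac_sobolev s p" and \<phi>: "\<And>n. \<phi> n \<in> test_functions \<Omega>"
    and lim: "(\<lambda>n. frac_sobolev_norm s p (\<lambda>x. u x - \<phi> n x)) \<longlonglongrightarrow> 0"
    using assms(4) unfolding frac_sobolev0_def by blast
  have "(\<lambda>x. u x - \<psi> x) \<in> frac_sobolev s p"
    using frac_sobolev_diff[OF assms(3) u test_function_in_frac_sobolev[OF assms(5,1-3)]] .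
  moreover have "(\<lambda>x. \<phi> n x - \<psi> x) \<in> test_functions \<Omega>" for n
    by (rule test_functions_diff[OF \<phi> assms(5)])
  ultimately show ?thesis using lim
    unfolding frac_sobolev0_def by (auto intro!: exI[of _ "\<lambda>n x. \<phi> n x - \<psi> x"])
qed

text \<open>Convergence in L^p gives convergence almost everywhere along a subsequence, as Fatou's
  lemma will require, and the convergence of the energies survives the passage to it.\<close>

lemma frac_sobolev0_approx:
  fixes u :: "'a::euclidean_space \<Rightarrow> real"
  assumes "0 < s" "s < 1" "0 < p" "u \<in> frac_sobolev0 s p \<Omega>"
  obtains \<phi> where "\<And>n::nat. \<phi> n \<in> test_functions \<Omega>"
    "(\<lambda>n. LINT z|(lborel \<Otimes>\<^sub>M lborel). \<bar>diff_quot s p u z - diff_quot s p (\<phi> n) z\<bar> powr p) \<longlonglongrightarrow> 0"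
    "AE x in lborel. (\<lambda>n. \<phi> n x) \<longlonglongrightarrow> u x"
proof -
  obtain \<phi> where u: "u \<in> frac_sobolev s p" and \<phi>: "\<And>n. \<phi> n \<in> test_functions \<Omega>"
    and lim: "(\<lambda>n. frac_sobolev_norm s p (\<lambda>x. u x - \<phi> n x)) \<longlonglongrightarrow> 0"
    using assms(4) unfolding frac_sobolev0_def by blast
  have G: "(\<lambda>n. LINT z|(lborel \<Otimes>\<^sub>M lborel). \<bar>diff_quot s p u z - diff_quot s p (\<phi> n) z\<bar> powr p) \<longlonglongrightarrow> 0"
    and I: "(\<lambda>n. LINT x|lborel. \<bar>u x - \<phi> n x\<bar> powr p) \<longlonglongrightarrow> 0"
    using lim unfolding frac_sobolev_norm_tendsto_0_iff[OF assms(3)] diff_quot_diff by auto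
  have "integrable lborel (\<lambda>x. \<bar>u x - \<phi> n x\<bar> powr p)" for n
    using frac_sobolev_diff[OF assms(3) u test_function_in_frac_sobolev[OF \<phi> assms(1-3)]]
    unfolding frac_sobolev_iff[OF assms(3)] by blast
  then obtain r :: "nat \<Rightarrow> nat" where r: "strict_mono r"
    and ae: "AE x in lborel. (\<lambda>n. \<bar>u x - \<phi> (r n) x\<bar> powr p) \<longlonglongrightarrow> 0"
    using tendsto_L1_AE_subseq[of lborel "\<lambda>n x. \<bar>u x - \<phi> n x\<bar> powr p"] I by auto
  have "AE x in lborel. (\<lambda>n. \<phi> (r n) x) \<longlonglongrightarrow> u x" using ae
  proof eventually_elim
    case (elim x)
    hence "(\<lambda>n. (\<bar>u x - \<phi> (r n) x\<bar> powr p) powr (1 / p)) \<longlonglongrightarrow> 0"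
      by (rule tendsto_zero_powrI[where b = "1 / p"]) (use assms in auto)
    hence "(\<lambda>n. \<bar>u x - \<phi> (r n) x\<bar>) \<longlonglongrightarrow> 0" using assms by (simp add: powr_powr)
    hence "(\<lambda>n. u x - \<phi> (r n) x) \<longlonglongrightarrow> 0" by (simp add: tendsto_rabs_zero_iff)
    hence "(\<lambda>n. u x - (u x - \<phi> (r n) x)) \<longlonglongrightarrow> u x - 0" by (intro tendsto_diff tendsto_const)
    thus ?case by simp
  qed
  moreover have "(\<lambda>n. LINT z|(lborel \<Otimes>\<^sub>M lborel). \<bar>diff_quot s p u z - diff_quot s p (\<phi> (r n)) z\<bar> powr p) \<longlonglongrightarrow> 0"
    using LIMSEQ_subseq_LIMSEQ[OF G r] by (simp add: o_def)
  ultimately show thesis using that[of "\<lambda>n. \<phi> (r n)"] \<phi> by blast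
qed

lemma frac_sobolev0_AE_zero:
  assumes "0 < s" "s < 1" "0 < p" "u \<in> frac_sobolev0 s p \<Omega>"
  shows "AE x in lborel. x \<notin> \<Omega> \<longrightarrow> u x = 0"
proof -
  obtain \<phi> where \<phi>: "\<And>n::nat. \<phi> n \<in> test_functions \<Omega>" and "AE x in lborel. (\<lambda>n. \<phi> n x) \<longlonglongrightarrow> u x"
    using frac_sobolev0_approx[OF assms] by blast
  from this(2) show ?thesis
  proof eventually_elim
    case (elim x)
    have "\<phi> n x = 0" if "x \<notin> \<Omega>" for n using \<phi>[of n] that unfolding test_functions_def by blast
    with elim show ?case by (auto simp: LIMSEQ_const_iff)
  qed
qed

text \<open>A null set in one factor yields null sets of pairs in either coordinate. This carries
  pointwise limits of functions over to their difference quotients.\<close>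

lemma AE_lborel_pair:
  assumes "AE x in lborel. P (x::'a::euclidean_space)"
  shows "AE z in lborel \<Otimes>\<^sub>M lborel. P (fst z) \<and> P (snd z)"
proof -
  obtain N where N [measurable]: "N \<in> sets lborel" and "emeasure lborel N = 0" "{x. \<not> P x} \<subseteq> N"
    using assms by (auto elim: AE_E)
  hence ae: "AE x in lborel. x \<notin> N" by (intro AE_not_in) auto
  have "AE z in lborel \<Otimes>\<^sub>M lborel. fst z \<notin> N \<and> snd z \<notin> N"
  proof (rule lborel_pair.AE_pair_measure)
    show "AE x in lborel. AE y in lborel. fst (x, y) \<notin> N \<and> snd (x, y) \<notin> N"
      using ae by eventually_elim (use ae in simp)
  qed measurable
  thus ?thesis by eventually_elim (use \<open>{x. \<not> P x} \<subseteq> N\<close> in auto)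
qed

lemma gagliardo_cong_AE:
  assumes [measurable]: "u \<in> borel_measurable borel" "v \<in> borel_measurable borel" and "0 < p"
    and "AE x in lborel. u x = v x"
  shows "gagliardo s p u = gagliardo s p v"
proof -
  have "(LINT z|(lborel \<Otimes>\<^sub>M lborel). gagliardo_integrand s p u z) = (LINT z|(lborel \<Otimes>\<^sub>M lborel). gagliardo_integrand s p v z)"
    unfolding gagliardo_integrand_diff_quot[OF assms(3)]
    by (rule integral_cong_AE; (measurable)?)
      (use AE_lborel_pair[OF assms(4)] in \<open>eventually_elim, simp add: diff_quot_def\<close>)
  thus ?thesis unfolding gagliardo_def by simp
qed

section \<open>Integrability and bounds of the pairing\<close>

text \<open>Links the integrand of the pairing to the product in \<open>Hoelder_powr\<close>. At a =
  0 both sides are 0, also when p < 2, by the convention that 0 to any power is 0.\<close>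

lemma abs_powr_mult_self:
  fixes a b p :: real
  shows "\<bar>\<bar>a\<bar> powr (p - 2) * a * b\<bar> = \<bar>a\<bar> powr (p - 1) * \<bar>b\<bar>"
proof (cases "a = 0")
  case False
  have "\<bar>a\<bar> powr (p - 1) = \<bar>a\<bar> powr (p - 2 + 1)" by simp
  also have "\<dots> = \<bar>a\<bar> powr (p - 2) * \<bar>a\<bar>" using False by (simp only: powr_add) simp
  finally show ?thesis by (simp add: abs_mult)
qed simp

lemma frac_sobolev_abs:
  assumes "0 < p" "v \<in> frac_sobolev s p"
  shows "(\<lambda>x. \<bar>v x\<bar>) \<in> frac_sobolev s p"
proof -
  have [measurable]: "v \<in> borel_measurable borel"
    and G: "integrable (lborel \<Otimes>\<^sub>M lborel) (\<lambda>z. \<bar>diff_quot s p v z\<bar> powr p)"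
    using assms unfolding frac_sobolev_iff[OF assms(1)] by auto
  have "integrable (lborel \<Otimes>\<^sub>M lborel) (\<lambda>z. \<bar>diff_quot s p (\<lambda>x. \<bar>v x\<bar>) z\<bar> powr p)"
  proof (rule Bochner_Integration.integrable_bound[OF G])
    show "AE z in lborel \<Otimes>\<^sub>M lborel. norm (\<bar>diff_quot s p (\<lambda>x. \<bar>v x\<bar>) z\<bar> powr p) \<le> norm (\<bar>diff_quot s p v z\<bar> powr p)"
      using assms by (auto intro!: powr_mono2 abs_diff_quot_le)
  qed measurable
  with assms show ?thesis unfolding frac_sobolev_iff[OF assms(1)] by auto
qed

lemma frac_p_Laplacian_integrable:
  assumes "1 < p" "u \<in> frac_sobolev s p" "v \<in> frac_sobolev s p"
  shows "integrable (lborel \<Otimes>\<^sub>M lborel) (\<lambda>z. \<bar>diff_quot s p u z\<bar> powr (p - 1) * \<bar>diff_quot s p v z\<bar>)"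
    and "integrable (lborel \<Otimes>\<^sub>M lborel)
      (\<lambda>z. \<bar>diff_quot s p u z\<bar> powr (p - 2) * diff_quot s p u z * diff_quot s p v z)"
proof -
  have p: "0 < p" using assms by simp
  have [measurable]: "u \<in> borel_measurable borel" "v \<in> borel_measurable borel"
    using assms frac_sobolev_iff[OF p] by auto
  show 1: "integrable (lborel \<Otimes>\<^sub>M lborel) (\<lambda>z. \<bar>diff_quot s p u z\<bar> powr (p - 1) * \<bar>diff_quot s p v z\<bar>)"
    by (rule integrable_powr_mult) (use assms frac_sobolev_iff[OF p] in auto)
  show "integrable (lborel \<Otimes>\<^sub>M lborel)
      (\<lambda>z. \<bar>diff_quot s p u z\<bar> powr (p - 2) * diff_quot s p u z * diff_quot s p v z)"
    by (rule Bochner_Integration.integrable_bound[OF 1]) (auto simp: abs_powr_mult_self)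
qed

lemma frac_p_Laplacian_diff:
  assumes "1 < p" "u \<in> frac_sobolev s p" "v \<in> frac_sobolev s p" "w \<in> frac_sobolev s p"
  shows "frac_p_Laplacian s p u (\<lambda>x. v x - w x) = frac_p_Laplacian s p u v - frac_p_Laplacian s p u w"
  using assms(1) frac_p_Laplacian_integrable(2)[OF assms(1,2,3)] frac_p_Laplacian_integrable(2)[OF assms(1,2,4)]
  by (simp add: frac_p_Laplacian_diff_quot diff_quot_diff right_diff_distrib)

text \<open>Allowing a dominating function \<open>w\<close> covers the case that \<open>v\<close> is
  the modulus or the smoothed modulus of \<open>w\<close>, as well as \<open>w\<close>
  itself.\<close>

lemma abs_frac_p_Laplacian_le:
  assumes "1 < p" "u \<in> frac_sobolev s p" "v \<in> frac_sobolev s p" "w \<in> frac_sobolev s p"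
    and "\<And>x y. \<bar>v x - v y\<bar> \<le> \<bar>w x - w y\<bar>"
  shows "\<bar>frac_p_Laplacian s p u v\<bar>
      \<le> (LINT z|(lborel \<Otimes>\<^sub>M lborel). \<bar>diff_quot s p u z\<bar> powr (p - 1) * \<bar>diff_quot s p w z\<bar>)"
proof -
  have "\<bar>frac_p_Laplacian s p u v\<bar>
     \<le> (LINT z|(lborel \<Otimes>\<^sub>M lborel). \<bar>\<bar>diff_quot s p u z\<bar> powr (p - 2) * diff_quot s p u z * diff_quot s p v z\<bar>)"
    using assms by (simp add: frac_p_Laplacian_diff_quot integral_abs_bound)
  also have "\<dots> \<le> (LINT z|(lborel \<Otimes>\<^sub>M lborel). \<bar>diff_quot s p u z\<bar> powr (p - 1) * \<bar>diff_quot s p w z\<bar>)"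
    unfolding abs_powr_mult_self using assms
    by (intro integral_mono frac_p_Laplacian_integrable mult_left_mono abs_diff_quot_le) auto
  finally show ?thesis .
qed

lemma frac_p_Laplacian_Hoelder:
  assumes "1 < p" "u \<in> frac_sobolev s p" "v \<in> frac_sobolev s p"
  shows "(LINT z|(lborel \<Otimes>\<^sub>M lborel). \<bar>diff_quot s p u z\<bar> powr (p - 1) * \<bar>diff_quot s p v z\<bar>)
    \<le> (gagliardo s p u powr p) powr (1 - 1 / p) * (gagliardo s p v powr p) powr (1 / p)"
proof -
  have p: "0 < p" using assms by simp
  have [measurable]: "u \<in> borel_measurable borel" "v \<in> borel_measurable borel"
    using assms frac_sobolev_iff[OF p] by auto
  show ?thesis
    unfolding gagliardo_powr[OF p]
    by (rule Hoelder_powr(1)) (use assms frac_sobolev_iff[OF p] in auto)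
qed

lemma frac_p_Laplacian_self:
  assumes "0 < p"
  shows "frac_p_Laplacian s p u u = gagliardo s p u powr p"
proof -
  have "\<bar>a\<bar> powr (p - 2) * a * a = \<bar>a\<bar> powr p" for a :: real
  proof (cases "a = 0")
    case False
    have "\<bar>a\<bar> powr p = \<bar>a\<bar> powr (p - 2 + 2)" by simp
    also have "\<dots> = \<bar>a\<bar> powr (p - 2) * \<bar>a\<bar> powr 2" by (rule powr_add)
    also have "\<bar>a\<bar> powr 2 = a * a" using False by (simp add: power2_eq_square)
    finally show ?thesis by simp
  qed simp
  thus ?thesis unfolding frac_p_Laplacian_diff_quot[OF assms] gagliardo_powr[OF assms] by simp
qed

lemma weighted_integral_cmult:
  "weighted_integral \<alpha> \<Omega> \<omega> (\<lambda>x. c * v x) = \<bar>c\<bar> powr (1 - \<alpha>) * weighted_integral \<alpha> \<Omega> \<omega> v"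
proof -
  have "weighted_integral \<alpha> \<Omega> \<omega> (\<lambda>x. c * v x)
      = (LINT x:\<Omega>|lborel. \<bar>c\<bar> powr (1 - \<alpha>) * (\<bar>v x\<bar> powr (1 - \<alpha>) * \<omega> x))"
    unfolding weighted_integral_def by (simp add: abs_mult powr_mult mult_ac)
  thus ?thesis unfolding weighted_integral_def by simp
qed

lemma gagliardo_cmult_powr:
  assumes "0 < p"
  shows "gagliardo s p (\<lambda>x. c * v x) powr p = \<bar>c\<bar> powr p * gagliardo s p v powr p"
  unfolding gagliardo_powr[OF assms] diff_quot_cmult abs_mult powr_mult by simp

text \<open>A bounded set has finite measure and the whole space does not, so an exceptional null
  set cannot contain the complement of \<Omega>.\<close>

lemma ex_outside_bounded:
  fixes \<Omega> :: "'a::euclidean_space set"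
  assumes "bounded \<Omega>" "open \<Omega>" "AE x in lborel. P x"
  obtains x where "x \<notin> \<Omega>" "P x"
proof -
  have "\<exists>x. x \<notin> \<Omega> \<and> P x"
  proof (rule ccontr)
    assume "\<not> (\<exists>x. x \<notin> \<Omega> \<and> P x)"
    with assms(3) have "AE x in lborel. x \<in> \<Omega> \<longleftrightarrow> x \<in> UNIV" by (auto elim: eventually_mono)
    hence "emeasure lborel \<Omega> = emeasure lborel (UNIV :: 'a set)"
      by (rule emeasure_eq_AE) (use assms in auto)
    thus False using emeasure_bounded_finite[OF assms(1)] by simp
  qed
  thus thesis using that by blast
qed

subsection \<open>The singular problem\<close>

locale singular_problem =
  fixes \<Omega> :: "'a::euclidean_space set" and s p \<alpha> :: real and \<omega> u :: "'a \<Rightarrow> real"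
  assumes open_domain: "open \<Omega>" and bounded_domain: "bounded \<Omega>"
    and s: "0 < s" "s < 1" and p: "1 < p" and \<alpha>: "0 < \<alpha>" "\<alpha> < 1"
    and \<omega>_integrable: "set_integrable lborel \<Omega> \<omega>"
    and \<omega>_nonzero: "\<not> (AE x\<in>\<Omega> in lborel. \<omega> x = 0)"
    and \<omega>_nonneg: "AE x\<in>\<Omega> in lborel. 0 \<le> \<omega> x"
    and weak_solution: "weak_solution s p \<alpha> \<Omega> \<omega> u"
begin

abbreviation Q :: "('a \<times> 'a) measure" where "Q \<equiv> lborel \<Otimes>\<^sub>M lborel"
abbreviation D :: "('a \<Rightarrow> real) \<Rightarrow> 'a \<times> 'a \<Rightarrow> real" where "D \<equiv> diff_quot s p"
abbreviation energy :: "('a \<Rightarrow> real) \<Rightarrow> real" where "energy v \<equiv> gagliardo s p v powr p"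
abbreviation pairing :: "('a \<Rightarrow> real) \<Rightarrow> real" where "pairing \<equiv> frac_p_Laplacian s p u"

text \<open>The right-hand side of the equation, continued by 0 outside \<Omega>, so that integrals
  over \<Omega> become integrals over the whole space.\<close>

definition weight :: "'a \<Rightarrow> real" where
  "weight x = (indicator \<Omega> x *\<^sub>R \<omega> x) / u x powr \<alpha>"

lemma p_pos: "0 < p" using p by simp

lemma u_frac_sobolev0: "u \<in> frac_sobolev0 s p \<Omega>"
  using weak_solution unfolding weak_solution_def by blast

lemma frac_sobolev0_D:
  assumes "v \<in> frac_sobolev0 s p \<Omega>"
  shows "v \<in> frac_sobolev s p" "v \<in> borel_measurable borel"
  using assms frac_sobolev_iff[OF p_pos] unfolding frac_sobolev0_def by auto

lemma u_measurable [measurable]: "u \<in> borel_measurable borel"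
  by (rule frac_sobolev0_D(2)[OF u_frac_sobolev0])

lemma domain_measurable [measurable]: "\<Omega> \<in> sets borel"
  using open_domain by simp

lemma \<omega>_measurable [measurable]: "(\<lambda>x. indicator \<Omega> x *\<^sub>R \<omega> x) \<in> borel_measurable borel"
  using borel_measurable_integrable[OF \<omega>_integrable[unfolded set_integrable_def]] by simp

lemma weight_measurable [measurable]: "weight \<in> borel_measurable borel"
  unfolding weight_def by measurable

lemma weight_nonneg: "AE x in lborel. 0 \<le> weight x"
  using \<omega>_nonneg by eventually_elim (auto simp: weight_def indicator_def)

section \<open>Positivity and local lower bounds of the solution\<close>

lemma u_bounded_below:
  assumes "cball x e \<subseteq> \<Omega>" "0 < e"
  obtains C where "0 < C" "AE y in lborel. y \<in> ball x e \<longrightarrow> C \<le> u y"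
proof -
  have "closure (ball x e) = cball x e" using assms by simp
  with assms have "open (ball x e) \<and> connected (ball x e) \<and> compact (closure (ball x e)) \<and> closure (ball x e) \<subseteq> \<Omega>"
    by simp
  hence "\<exists>C>0. AE y\<in>ball x e in lborel. C \<le> u y"
    using weak_solution unfolding weak_solution_def by blast
  thus thesis using that by blast
qed

text \<open>Balls are connected, as the lower bounds in the definition of a weak solution demand. As
  an open cover of \<Omega> they have countable subcovers, for positivity on \<Omega>, and finite
  ones for each compact subset, for a uniform lower bound.\<close>

definition ball_cover :: "'a set set" where
  "ball_cover = {ball x e | x e. 0 < e \<and> cball x e \<subseteq> \<Omega>}"

lemma Union_ball_cover: "\<Union>ball_cover = \<Omega>"
proof
  show "\<Omega> \<subseteq> \<Union>ball_cover"
  proof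
    fix x assume "x \<in> \<Omega>"
    then obtain e where "0 < e" "cball x e \<subseteq> \<Omega>" using open_domain open_contains_cball by blast
    thus "x \<in> \<Union>ball_cover" unfolding ball_cover_def by (auto intro!: exI[of _ "ball x e"])
  qed
qed (auto simp: ball_cover_def)

lemma ball_cover_bound:
  assumes "S \<in> ball_cover"
  shows "\<exists>C>0. AE y in lborel. y \<in> S \<longrightarrow> C \<le> u y"
proof -
  obtain x e where S: "S = ball x e" "0 < e" "cball x e \<subseteq> \<Omega>"
    using assms unfolding ball_cover_def by blast
  obtain C where "0 < C" "AE y in lborel. y \<in> ball x e \<longrightarrow> C \<le> u y"
    by (rule u_bounded_below[OF S(3,2)])
  thus ?thesis unfolding S(1) by blast
qed

lemma open_ball_cover: "S \<in> ball_cover \<Longrightarrow> open S"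
  unfolding ball_cover_def by auto

lemma u_pos: "AE x in lborel. x \<in> \<Omega> \<longrightarrow> 0 < u x"
proof -
  obtain F where F: "F \<subseteq> ball_cover" "countable F" "\<Union>F = \<Omega>"
    by (rule Lindelof[of ball_cover]) (use open_ball_cover Union_ball_cover in auto)
  have "\<forall>S\<in>F. AE x in lborel. x \<in> S \<longrightarrow> 0 < u x"
  proof
    fix S assume "S \<in> F"
    then obtain C where "0 < C" "AE y in lborel. y \<in> S \<longrightarrow> C \<le> u y" using F ball_cover_bound by blast
    from this(2) show "AE x in lborel. x \<in> S \<longrightarrow> 0 < u x"
      by eventually_elim (use \<open>0 < C\<close> in auto)
  qed
  hence "AE x in lborel. \<forall>S\<in>F. x \<in> S \<longrightarrow> 0 < u x" by (subst AE_ball_countable[OF F(2)])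
  thus ?thesis by eventually_elim (use F in auto)
qed

lemma u_nonneg: "AE x in lborel. 0 \<le> u x"
  using u_pos frac_sobolev0_AE_zero[OF s p_pos u_frac_sobolev0]
proof eventually_elim
  case (elim x)
  thus ?case by (cases "x \<in> \<Omega>") auto
qed

lemma u_bounded_below_compact:
  assumes "compact K" "K \<subseteq> \<Omega>"
  obtains C where "0 < C" "AE x in lborel. x \<in> K \<longrightarrow> C \<le> u x"
proof -
  obtain F where F: "F \<subseteq> ball_cover" "finite F" "K \<subseteq> \<Union>F"
    by (rule compactE[OF assms(1), of ball_cover]) (use assms(2) open_ball_cover Union_ball_cover in auto)
  obtain c where c: "\<And>S. S \<in> F \<Longrightarrow> 0 < c S" "\<And>S. S \<in> F \<Longrightarrow> AE y in lborel. y \<in> S \<longrightarrow> c S \<le> u y"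
    using ball_cover_bound F(1) by (metis subsetD)
  \<comment> \<open>Inserting 1 keeps the minimum defined and positive even when the subcover
    \<open>F\<close> is empty.\<close>
  define C where "C = Min (insert 1 (c ` F))"
  have "0 < C" unfolding C_def using F c by auto
  have le: "C \<le> c S" if "S \<in> F" for S unfolding C_def using F that by auto
  have "AE x in lborel. \<forall>S\<in>F. x \<in> S \<longrightarrow> c S \<le> u x"
    using c F by (simp add: AE_finite_all)
  hence "AE x in lborel. x \<in> K \<longrightarrow> C \<le> u x"
  proof eventually_elim
    case (elim x)
    show ?case using elim F(3) le by (meson UnionE order_trans subsetD)
  qed
  with \<open>0 < C\<close> that show thesis by blast
qed

section \<open>The weak formulation beyond test functions\<close>

lemma test_function_frac_sobolev: "\<phi> \<in> test_functions \<Omega> \<Longrightarrow> \<phi> \<in> frac_sobolev s p"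
  by (rule test_function_in_frac_sobolev) (use s p in auto)

lemma test_function_measurable: "\<phi> \<in> test_functions \<Omega> \<Longrightarrow> \<phi> \<in> borel_measurable borel"
  using test_function_frac_sobolev[of \<phi>] frac_sobolev_iff[OF p_pos, of \<phi> s] by blast

text \<open>On the support of \<phi> the solution is bounded below, so the integrand is at most a
  multiple of \<omega>. Integrability is shown apart from the equation, because the Bochner integral
  of a non-integrable function is 0.\<close>

lemma weak_form:
  assumes \<phi>: "\<phi> \<in> test_functions \<Omega>"
  shows "integrable lborel (\<lambda>x. weight x * \<phi> x)" "(LINT x|lborel. weight x * \<phi> x) = pairing \<phi>"
proof -
  note [measurable] = test_function_measurable[OF \<phi>]
  obtain K where K: "compact K" "K \<subseteq> \<Omega>" "\<And>x. x \<notin> K \<Longrightarrow> \<phi> x = 0"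
    using \<phi> unfolding test_functions_def by blast
  obtain M where M: "0 \<le> M" "\<And>x. \<bar>\<phi> x\<bar> \<le> M" using test_function_bounded[OF \<phi>] by blast
  obtain C where C: "0 < C" "AE x in lborel. x \<in> K \<longrightarrow> C \<le> u x"
    using u_bounded_below_compact[OF K(1,2)] by blast
  show "integrable lborel (\<lambda>x. weight x * \<phi> x)"
  proof (rule Bochner_Integration.integrable_bound)
    show "integrable lborel (\<lambda>x. (M / C powr \<alpha>) *\<^sub>R (indicator \<Omega> x *\<^sub>R \<omega> x))"
      using \<omega>_integrable unfolding set_integrable_def by (intro integrable_scaleR_right)
    show "AE x in lborel. norm (weight x * \<phi> x) \<le> norm ((M / C powr \<alpha>) *\<^sub>R (indicator \<Omega> x *\<^sub>R \<omega> x))"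
      using C(2)
    proof eventually_elim
      case (elim x)
      show ?case
      proof (cases "x \<in> K")
        case True
        with elim have "C powr \<alpha> \<le> u x powr \<alpha>" using C \<alpha> by (intro powr_mono2) auto
        moreover have "0 < C powr \<alpha>" using C by simp
        ultimately have "\<bar>\<phi> x\<bar> / u x powr \<alpha> \<le> M / C powr \<alpha>" using M by (intro frac_le) auto
        hence "\<bar>indicator \<Omega> x *\<^sub>R \<omega> x\<bar> * (\<bar>\<phi> x\<bar> / u x powr \<alpha>) \<le> \<bar>indicator \<Omega> x *\<^sub>R \<omega> x\<bar> * (M / C powr \<alpha>)"
          by (intro mult_left_mono) auto
        thus ?thesis using M C by (simp add: weight_def abs_mult mult_ac)
      qed (use K(3) in simp)
    qed
  qed measurable
  have "pairing \<phi> = (LINT x:\<Omega>|lborel. \<omega> x * \<phi> x / u x powr \<alpha>)"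
    using weak_solution \<phi> unfolding weak_solution_def by blast
  also have "\<dots> = (LINT x|lborel. weight x * \<phi> x)"
    unfolding set_lebesgue_integral_def weight_def by (intro Bochner_Integration.integral_cong) auto
  finally show "(LINT x|lborel. weight x * \<phi> x) = pairing \<phi>" ..
qed

text \<open>
  The functions \<open>\<psi> n\<close> are test functions tending to \<open>\<bar>v\<bar>\<close> almost everywhere, so that Fatou's lemma
  applies on both sides of the weak formulation; on the pairing side it is applied to the
  nonnegative difference between \<open>\<bar>D u\<bar> powr (p - 1) * \<bar>D (\<phi> n)\<bar>\<close> and the integrand of the pairing.
\<close>

lemma weak_form_abs:
  assumes v: "v \<in> frac_sobolev0 s p \<Omega>"
  shows "integrable lborel (\<lambda>x. weight x * \<bar>v x\<bar>)"
    and "(LINT x|lborel. weight x * \<bar>v x\<bar>) \<le> pairing (\<lambda>x. \<bar>v x\<bar>)"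
proof -
  note vs = frac_sobolev0_D[OF v] and us = frac_sobolev0_D(1)[OF u_frac_sobolev0]
  note [measurable] = vs(2)
  obtain \<phi> where \<phi>: "\<And>n::nat. \<phi> n \<in> test_functions \<Omega>"
    and G: "(\<lambda>n. LINT z|Q. \<bar>D v z - D (\<phi> n) z\<bar> powr p) \<longlonglongrightarrow> 0"
    and ae: "AE x in lborel. (\<lambda>n. \<phi> n x) \<longlonglongrightarrow> v x"
    using frac_sobolev0_approx[OF s p_pos v] by blast
  have [measurable]: "\<phi> n \<in> borel_measurable borel" for n by (rule test_function_measurable[OF \<phi>])
  note \<phi>s = test_function_frac_sobolev[OF \<phi>]
  \<comment> \<open>The smoothing parameter tends to 0 and, through \<open>Suc n\<close>, is defined
    and positive from n = 0 on.\<close>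
  define \<psi> where "\<psi> n x = smooth_abs (inverse (real (Suc n))) (\<phi> n x)" for n x
  have \<psi>: "\<psi> n \<in> test_functions \<Omega>" for n
    unfolding \<psi>_def by (rule smooth_abs_test_function[OF \<phi>]) simp
  have [measurable]: "\<psi> n \<in> borel_measurable borel" for n by (rule test_function_measurable[OF \<psi>])
  note \<psi>s = test_function_frac_sobolev[OF \<psi>]
  have \<psi>_nonneg: "0 \<le> \<psi> n x" for n x unfolding \<psi>_def by (rule smooth_abs_nonneg) simp
  have \<psi>_lip: "\<bar>\<psi> n x - \<psi> n y\<bar> \<le> \<bar>\<phi> n x - \<phi> n y\<bar>" for n x y
    unfolding \<psi>_def by (rule smooth_abs_lipschitz) simp
  have \<psi>_lim: "AE x in lborel. (\<lambda>n. \<psi> n x) \<longlonglongrightarrow> \<bar>v x\<bar>"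
    using ae unfolding \<psi>_def
    by eventually_elim (intro smooth_abs_tendsto LIMSEQ_inverse_real_of_nat)
  define H where "H f = (LINT z|Q. \<bar>D u z\<bar> powr (p - 1) * \<bar>D f z\<bar>)" for f
  have HI: "integrable Q (\<lambda>z. \<bar>D u z\<bar> powr (p - 1) * \<bar>D f z\<bar>)" if "f \<in> frac_sobolev s p" for f
    by (rule frac_p_Laplacian_integrable(1)[OF p us that])
  \<comment> \<open>The moduli of the quotients of \<phi> n and v differ by at most that of v -
    \<phi> n, whose energy tends to 0; Hoelder's inequality turns this into convergence of the
    integrals.\<close>
  have H_lim: "(\<lambda>n. H (\<phi> n)) \<longlonglongrightarrow> H v"
  proof (rule LIM_zero_cancel, rule Lim_null_comparison)
    show "(\<lambda>n. energy u powr (1 - 1 / p) * (LINT z|Q. \<bar>D v z - D (\<phi> n) z\<bar> powr p) powr (1 / p)) \<longlonglongrightarrow> 0"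
      by (intro tendsto_mult_right_zero tendsto_zero_powrI[OF G tendsto_const]) (use p in auto)
    show "\<forall>\<^sub>F n in sequentially. norm (H (\<phi> n) - H v)
        \<le> energy u powr (1 - 1 / p) * (LINT z|Q. \<bar>D v z - D (\<phi> n) z\<bar> powr p) powr (1 / p)"
    proof (intro always_eventually allI)
      fix n
      have d: "(\<lambda>x. v x - \<phi> n x) \<in> frac_sobolev s p" by (rule frac_sobolev_diff[OF p_pos vs(1) \<phi>s])
      have "H (\<phi> n) - H v = (LINT z|Q. \<bar>D u z\<bar> powr (p - 1) * \<bar>D (\<phi> n) z\<bar> - \<bar>D u z\<bar> powr (p - 1) * \<bar>D v z\<bar>)"
        unfolding H_def using HI[OF \<phi>s] HI[OF vs(1)] by simp
      hence "norm (H (\<phi> n) - H v) \<le> (LINT z|Q. \<bar>\<bar>D u z\<bar> powr (p - 1) * \<bar>D (\<phi> n) z\<bar> - \<bar>D u z\<bar> powr (p - 1) * \<bar>D v z\<bar>\<bar>)"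
        by (simp add: integral_abs_bound)
      also have "\<dots> \<le> H (\<lambda>x. v x - \<phi> n x)"
        unfolding H_def
      proof (rule integral_mono)
        fix z
        have "\<bar>\<bar>D (\<phi> n) z\<bar> - \<bar>D v z\<bar>\<bar> \<le> \<bar>D v z - D (\<phi> n) z\<bar>" by simp
        from mult_left_mono[OF this, of "\<bar>D u z\<bar> powr (p - 1)"]
        show "\<bar>\<bar>D u z\<bar> powr (p - 1) * \<bar>D (\<phi> n) z\<bar> - \<bar>D u z\<bar> powr (p - 1) * \<bar>D v z\<bar>\<bar>
            \<le> \<bar>D u z\<bar> powr (p - 1) * \<bar>D (\<lambda>x. v x - \<phi> n x) z\<bar>"
          by (simp add: diff_quot_diff abs_mult right_diff_distrib[symmetric])
      qed (use HI[OF \<phi>s] HI[OF vs(1)] HI[OF d] in auto)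
      also have "\<dots> \<le> energy u powr (1 - 1 / p) * (LINT z|Q. \<bar>D v z - D (\<phi> n) z\<bar> powr p) powr (1 / p)"
        using frac_p_Laplacian_Hoelder[OF p us d]
        unfolding H_def by (simp add: gagliardo_powr[OF p_pos] diff_quot_diff)
      finally show "norm (H (\<phi> n) - H v)
        \<le> energy u powr (1 - 1 / p) * (LINT z|Q. \<bar>D v z - D (\<phi> n) z\<bar> powr p) powr (1 / p)" .
    qed
  qed
  have le: "\<bar>pairing (\<psi> n)\<bar> \<le> H (\<phi> n)" for n
    unfolding H_def by (rule abs_frac_p_Laplacian_le[OF p us \<psi>s \<phi>s \<psi>_lip])
  \<comment> \<open>Boundedness of the pairings with \<psi> n gives a limit \<open>l\<close> along a
    subsequence. It is the intermediate value: the weighted integral of |v| is at most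
    \<open>l\<close>, and \<open>l\<close> at most the pairing with |v|.\<close>
  have "Bseq (\<lambda>n. H (\<phi> n))" using H_lim convergentI convergent_imp_Bseq by blast
  then obtain M where M: "\<And>n. \<bar>H (\<phi> n)\<bar> \<le> M" unfolding Bseq_def by auto
  have "\<bar>pairing (\<psi> n)\<bar> \<le> M" for n using le[of n] M[of n] by linarith
  hence "bounded (range (\<lambda>n. pairing (\<psi> n)))" unfolding bounded_iff by auto
  then obtain l r where r: "strict_mono (r :: nat \<Rightarrow> nat)" and l: "(\<lambda>n. pairing (\<psi> (r n))) \<longlonglongrightarrow> l"
    using bounded_imp_convergent_subsequence[of "\<lambda>n. pairing (\<psi> n)"] by (auto simp: o_def)
  have sub: "(\<lambda>n. f (r n)) \<longlonglongrightarrow> a" if "f \<longlonglongrightarrow> a" for f :: "nat \<Rightarrow> real" and a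
    using LIMSEQ_subseq_LIMSEQ[OF that r] by (simp add: o_def)
  have "integrable lborel (\<lambda>x. weight x * \<bar>v x\<bar>) \<and> (LINT x|lborel. weight x * \<bar>v x\<bar>) \<le> l"
  proof (intro conjI)
    have "AE x in lborel. (\<lambda>n. weight x * \<psi> (r n) x) \<longlonglongrightarrow> weight x * \<bar>v x\<bar>"
      using \<psi>_lim by eventually_elim (intro tendsto_mult_left sub)
    moreover have "AE x in lborel. 0 \<le> weight x * \<psi> (r n) x" for n
      using weight_nonneg by eventually_elim (use \<psi>_nonneg in simp)
    moreover have "(\<lambda>n. LINT x|lborel. weight x * \<psi> (r n) x) \<longlonglongrightarrow> l" using l weak_form(2)[OF \<psi>] by simp
    ultimately show "integrable lborel (\<lambda>x. weight x * \<bar>v x\<bar>)" "(LINT x|lborel. weight x * \<bar>v x\<bar>) \<le> l"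
      using Fatou_integral[of lborel "\<lambda>n x. weight x * \<psi> (r n) x" "\<lambda>x. weight x * \<bar>v x\<bar>" l] weak_form(1)[OF \<psi>]
      by simp_all
  qed
  \<comment> \<open>The integral of \<open>g\<close> is \<open>H v\<close> minus the pairing with
    |v|, and Fatou's lemma bounds it by \<open>H v - l\<close>; cancelling \<open>H v\<close> gives
    the upper bound for \<open>l\<close>.\<close>
  moreover have "l \<le> pairing (\<lambda>x. \<bar>v x\<bar>)"
  proof -
    define P where "P f z = \<bar>D u z\<bar> powr (p - 2) * D u z * D f z" for f z
    have PI: "integrable Q (P f)" if "f \<in> frac_sobolev s p" for f
      unfolding P_def by (rule frac_p_Laplacian_integrable(2)[OF p us that])
    have Pint: "integral\<^sup>L Q (P f) = pairing f" for f
      unfolding P_def frac_p_Laplacian_diff_quot[OF p_pos] ..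
    note av = frac_sobolev_abs[OF p_pos vs(1)]
    define F where "F n z = \<bar>D u z\<bar> powr (p - 1) * \<bar>D (\<phi> (r n)) z\<bar> - P (\<psi> (r n)) z" for n z
    define g where "g z = \<bar>D u z\<bar> powr (p - 1) * \<bar>D v z\<bar> - P (\<lambda>x. \<bar>v x\<bar>) z" for z
    have "integral\<^sup>L Q g \<le> H v - l"
    proof (rule Fatou_integral(2)[of Q F])
      show "integrable Q (F n)" for n unfolding F_def using HI[OF \<phi>s] PI[OF \<psi>s] by simp
      show "AE z in Q. 0 \<le> F n z" for n
      proof (rule AE_I2)
        fix z
        have "P (\<psi> (r n)) z \<le> \<bar>D u z\<bar> powr (p - 1) * \<bar>D (\<psi> (r n)) z\<bar>"
          using abs_powr_mult_self[of "D u z" p "D (\<psi> (r n)) z"] unfolding P_def by linarith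
        also have "\<dots> \<le> \<bar>D u z\<bar> powr (p - 1) * \<bar>D (\<phi> (r n)) z\<bar>"
          by (intro mult_left_mono abs_diff_quot_le \<psi>_lip) simp
        finally show "0 \<le> F n z" unfolding F_def by simp
      qed
      show "g \<in> borel_measurable Q" unfolding g_def P_def by measurable
      show "AE z in Q. (\<lambda>n. F n z) \<longlonglongrightarrow> g z"
        using AE_lborel_pair[OF ae] AE_lborel_pair[OF \<psi>_lim]
      proof eventually_elim
        case (elim z)
        hence "(\<lambda>n. \<phi> (r n) (fst z)) \<longlonglongrightarrow> v (fst z)" "(\<lambda>n. \<phi> (r n) (snd z)) \<longlonglongrightarrow> v (snd z)"
          "(\<lambda>n. \<psi> (r n) (fst z)) \<longlonglongrightarrow> \<bar>v (fst z)\<bar>" "(\<lambda>n. \<psi> (r n) (snd z)) \<longlonglongrightarrow> \<bar>v (snd z)\<bar>"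
          by (auto intro: sub)
        thus ?case unfolding F_def g_def P_def diff_quot_def divide_inverse by (intro tendsto_intros)
      qed
      have "integral\<^sup>L Q (F n) = H (\<phi> (r n)) - pairing (\<psi> (r n))" for n
        unfolding F_def H_def Pint[symmetric] using HI[OF \<phi>s] PI[OF \<psi>s] by simp
      thus "(\<lambda>n. integral\<^sup>L Q (F n)) \<longlonglongrightarrow> H v - l"
        using tendsto_diff[OF sub[OF H_lim] l] by simp
    qed
    also have "integral\<^sup>L Q g = H v - pairing (\<lambda>x. \<bar>v x\<bar>)"
      unfolding g_def H_def Pint[symmetric] using HI[OF vs(1)] PI[OF av] by simp
    finally show ?thesis by simp
  qed
  ultimately show "integrable lborel (\<lambda>x. weight x * \<bar>v x\<bar>)"
    and "(LINT x|lborel. weight x * \<bar>v x\<bar>) \<le> pairing (\<lambda>x. \<bar>v x\<bar>)" by auto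
qed

text \<open>The links of the chain are recorded separately because each of them has to be an
  equality in the equality case.\<close>

lemma weak_form_abs_bound:
  assumes v: "v \<in> frac_sobolev0 s p \<Omega>"
  shows "pairing (\<lambda>x. \<bar>v x\<bar>) \<le> (LINT z|Q. \<bar>D u z\<bar> powr (p - 1) * \<bar>D v z\<bar>)"
    and "(LINT z|Q. \<bar>D u z\<bar> powr (p - 1) * \<bar>D v z\<bar>) \<le> energy u powr (1 - 1 / p) * energy v powr (1 / p)"
    and "(LINT x|lborel. weight x * \<bar>v x\<bar>) \<le> energy u powr (1 - 1 / p) * energy v powr (1 / p)"
proof -
  note vs = frac_sobolev0_D(1)[OF v] and us = frac_sobolev0_D(1)[OF u_frac_sobolev0]
  show 1: "pairing (\<lambda>x. \<bar>v x\<bar>) \<le> (LINT z|Q. \<bar>D u z\<bar> powr (p - 1) * \<bar>D v z\<bar>)"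
    using abs_frac_p_Laplacian_le[OF p us frac_sobolev_abs[OF p_pos vs] vs abs_triangle_ineq3] by linarith
  show 2: "(LINT z|Q. \<bar>D u z\<bar> powr (p - 1) * \<bar>D v z\<bar>) \<le> energy u powr (1 - 1 / p) * energy v powr (1 / p)"
    by (rule frac_p_Laplacian_Hoelder[OF p us vs])
  show "(LINT x|lborel. weight x * \<bar>v x\<bar>) \<le> energy u powr (1 - 1 / p) * energy v powr (1 / p)"
    using weak_form_abs(2)[OF v] 1 2 by linarith
qed

text \<open>The equation is available for test functions, so \<open>u\<close> is approximated by
  \<phi> n. Both sides differ from the pairing with \<phi> n by at most \<open>b n\<close>: the
  energy by Hoelder's inequality, the integral by the bound on the weighted integral of |u - \<phi>
  n|.\<close>

lemma energy_u: "energy u = (LINT x|lborel. weight x * u x)"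
proof -
  note us = frac_sobolev0_D(1)[OF u_frac_sobolev0]
  have wu: "integrable lborel (\<lambda>x. weight x * u x)"
    by (rule Bochner_Integration.integrable_bound[OF weak_form_abs(1)[OF u_frac_sobolev0]])
      (auto simp: abs_mult)
  obtain \<phi> where \<phi>: "\<And>n::nat. \<phi> n \<in> test_functions \<Omega>"
    and G: "(\<lambda>n. LINT z|Q. \<bar>D u z - D (\<phi> n) z\<bar> powr p) \<longlonglongrightarrow> 0"
    using frac_sobolev0_approx[OF s p_pos u_frac_sobolev0] by blast
  note \<phi>s = test_function_frac_sobolev[OF \<phi>]
  define b where "b n = energy u powr (1 - 1 / p) * (LINT z|Q. \<bar>D u z - D (\<phi> n) z\<bar> powr p) powr (1 / p)" for n
  have b: "b \<longlonglongrightarrow> 0"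
    unfolding b_def by (intro tendsto_mult_right_zero tendsto_zero_powrI[OF G tendsto_const]) (use p in auto)
  have "\<bar>energy u - (LINT x|lborel. weight x * u x)\<bar> \<le> 2 * b n" for n
  proof -
    let ?d = "\<lambda>x. u x - \<phi> n x"
    have d: "?d \<in> frac_sobolev0 s p \<Omega>"
      by (rule frac_sobolev0_diff_test_function[OF s p_pos u_frac_sobolev0 \<phi>])
    have bn: "b n = energy u powr (1 - 1 / p) * energy ?d powr (1 / p)"
      unfolding b_def by (simp add: gagliardo_powr[OF p_pos] diff_quot_diff)
    have "\<bar>pairing ?d\<bar> \<le> (LINT z|Q. \<bar>D u z\<bar> powr (p - 1) * \<bar>D ?d z\<bar>)"
      using frac_sobolev0_D(1)[OF d] by (intro abs_frac_p_Laplacian_le p us) auto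
    also have "\<dots> \<le> b n" unfolding bn by (rule weak_form_abs_bound(2)[OF d])
    finally have 1: "\<bar>energy u - pairing (\<phi> n)\<bar> \<le> b n"
      using frac_p_Laplacian_diff[OF p us us \<phi>s] frac_p_Laplacian_self[OF p_pos, of s u] by simp
    have "(LINT x|lborel. weight x * u x) - pairing (\<phi> n) = (LINT x|lborel. weight x * ?d x)"
      using wu weak_form[OF \<phi>] by (simp add: right_diff_distrib)
    also have "\<bar>\<dots>\<bar> \<le> (LINT x|lborel. \<bar>weight x * ?d x\<bar>)" by (rule integral_abs_bound)
    also have "\<dots> = (LINT x|lborel. weight x * \<bar>?d x\<bar>)"
      by (rule integral_cong_AE)
        (use weight_nonneg test_function_measurable[OF \<phi>] in \<open>auto simp: abs_mult elim: eventually_mono\<close>)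
    also have "\<dots> \<le> b n" unfolding bn by (rule weak_form_abs_bound(3)[OF d])
    finally show ?thesis using 1 by linarith
  qed
  moreover have "(\<lambda>n. 2 * b n) \<longlonglongrightarrow> 0" using b by (rule tendsto_mult_right_zero)
  ultimately have "\<bar>energy u - (LINT x|lborel. weight x * u x)\<bar> \<le> 0"
    by (intro LIMSEQ_le_const[of "\<lambda>n. 2 * b n" 0]) auto
  thus ?thesis by simp
qed

lemma integrable_weight_mult:
  assumes "v \<in> frac_sobolev0 s p \<Omega>"
  shows "integrable lborel (\<lambda>x. weight x * v x)"
  using frac_sobolev0_D(2)[OF assms]
  by (intro Bochner_Integration.integrable_bound[OF weak_form_abs(1)[OF assms]]) (auto simp: abs_mult)

section \<open>The sharp bound for the weighted integral\<close>

lemma weighted_integral_alt: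
  "weighted_integral \<alpha> \<Omega> \<omega> v = (LINT x|lborel. (indicator \<Omega> x *\<^sub>R \<omega> x) * \<bar>v x\<bar> powr (1 - \<alpha>))"
  unfolding weighted_integral_def set_lebesgue_integral_def by (simp add: mult_ac)

lemma weighted_integral_nonneg: "0 \<le> weighted_integral \<alpha> \<Omega> \<omega> v"
  unfolding weighted_integral_alt
  by (rule integral_nonneg_AE) (use \<omega>_nonneg in \<open>auto simp: indicator_def elim: eventually_mono\<close>)

text \<open>Since u > 0 in \<Omega>, both integrands are \<omega> u^(1 - \<alpha>). The normalizing
  factor of \<open>u\<close> thus becomes a power of its energy.\<close>

lemma weighted_integral_u: "weighted_integral \<alpha> \<Omega> \<omega> u = energy u"
  unfolding weighted_integral_alt energy_u
proof (rule integral_cong_AE)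
  show "AE x in lborel. indicator \<Omega> x *\<^sub>R \<omega> x * \<bar>u x\<bar> powr (1 - \<alpha>) = weight x * u x"
    using u_pos by eventually_elim (auto simp: weight_def indicator_def powr_diff)
qed measurable

text \<open>Energy 0 would make \<open>weight x * u x\<close> vanish almost everywhere, and with it
  \<omega> on \<Omega>, because u is positive there.\<close>

lemma energy_u_pos: "0 < energy u"
proof (rule ccontr)
  assume "\<not> 0 < energy u"
  hence "energy u = 0" using powr_ge_zero[of "gagliardo s p u" p] by linarith
  hence z: "(LINT x|lborel. weight x * u x) = 0" using energy_u by simp
  have "AE x in lborel. 0 \<le> weight x * u x" using weight_nonneg u_nonneg by eventually_elim simp
  hence "AE x in lborel. weight x * u x = 0"
    using z integral_nonneg_eq_0_iff_AE[OF integrable_weight_mult[OF u_frac_sobolev0]] by simp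
  hence "AE x\<in>\<Omega> in lborel. \<omega> x = 0"
    using u_pos by eventually_elim (auto simp: weight_def)
  with \<omega>_nonzero show False by blast
qed

lemma weighted_integral_le:
  assumes v: "v \<in> frac_sobolev0 s p \<Omega>"
  shows "weighted_integral \<alpha> \<Omega> \<omega> v
    \<le> (LINT x|lborel. weight x * \<bar>v x\<bar>) powr (1 - \<alpha>) * energy u powr \<alpha>"
proof -
  note [measurable] = frac_sobolev0_D(2)[OF v]
  let ?q = "1 / (1 - \<alpha>)"
  \<comment> \<open>With the exponent 1 / (1 - \<alpha>), the product in Hoelder's inequality is
    (weight u)^\<alpha> times (weight |v|)^(1 - \<alpha>), in which the powers of u cancel.\<close>
  define f where "f x = \<bar>weight x * u x\<bar> powr (1 - \<alpha>)" for x
  define g where "g x = \<bar>weight x * v x\<bar> powr (1 - \<alpha>)" for x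
  have [measurable]: "f \<in> borel_measurable borel" "g \<in> borel_measurable borel"
    unfolding f_def g_def by measurable
  have q: "1 < ?q" using \<alpha> by simp
  have fq: "\<bar>f x\<bar> powr ?q = \<bar>weight x * u x\<bar>" and gq: "\<bar>g x\<bar> powr ?q = \<bar>weight x * v x\<bar>" for x
    unfolding f_def g_def using \<alpha> by (simp_all add: powr_powr)
  have fq1: "\<bar>f x\<bar> powr (?q - 1) = \<bar>weight x * u x\<bar> powr \<alpha>" for x
    unfolding f_def using \<alpha> by (simp add: powr_powr right_diff_distrib)
  have "(LINT x|lborel. \<bar>f x\<bar> powr (?q - 1) * \<bar>g x\<bar>)
      \<le> (LINT x|lborel. \<bar>f x\<bar> powr ?q) powr (1 - 1 / ?q) * (LINT x|lborel. \<bar>g x\<bar> powr ?q) powr (1 / ?q)"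
  proof (rule Hoelder_powr(1)[OF q])
    show "f \<in> borel_measurable lborel" "g \<in> borel_measurable lborel" by simp_all
    show "integrable lborel (\<lambda>x. \<bar>f x\<bar> powr ?q)" "integrable lborel (\<lambda>x. \<bar>g x\<bar> powr ?q)"
      unfolding fq gq using integrable_weight_mult v u_frac_sobolev0 by auto
  qed
  also have "(LINT x|lborel. \<bar>f x\<bar> powr (?q - 1) * \<bar>g x\<bar>) = weighted_integral \<alpha> \<Omega> \<omega> v"
    unfolding weighted_integral_alt
  proof (rule integral_cong_AE)
    show "AE x in lborel. \<bar>f x\<bar> powr (?q - 1) * \<bar>g x\<bar> = indicator \<Omega> x *\<^sub>R \<omega> x * \<bar>v x\<bar> powr (1 - \<alpha>)"
      using u_pos \<omega>_nonneg weight_nonneg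
    proof eventually_elim
      case (elim x)
      show ?case
      proof (cases "x \<in> \<Omega>")
        case True
        have "\<bar>f x\<bar> powr (?q - 1) * \<bar>g x\<bar> = (weight x powr \<alpha> * weight x powr (1 - \<alpha>)) * (u x powr \<alpha> * \<bar>v x\<bar> powr (1 - \<alpha>))"
          unfolding fq1 unfolding g_def using elim True by (simp add: abs_mult powr_mult)
        also have "weight x powr \<alpha> * weight x powr (1 - \<alpha>) = weight x"
          using elim by (simp add: powr_add[symmetric])
        also have "weight x * (u x powr \<alpha> * \<bar>v x\<bar> powr (1 - \<alpha>)) = \<omega> x * \<bar>v x\<bar> powr (1 - \<alpha>)"
          using elim True by (simp add: weight_def)
        finally show ?thesis using True by simp
      next
        case False
        thus ?thesis by (simp add: g_def weight_def)
      qed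
    qed
  qed measurable
  also have "1 - 1 / ?q = \<alpha>" by simp
  also have "1 / ?q = 1 - \<alpha>" by simp
  also have "(LINT x|lborel. \<bar>f x\<bar> powr ?q) = energy u"
    unfolding fq energy_u
    by (rule integral_cong_AE) (use weight_nonneg u_nonneg in \<open>auto elim: eventually_elim2\<close>)
  also have "(LINT x|lborel. \<bar>g x\<bar> powr ?q) = (LINT x|lborel. weight x * \<bar>v x\<bar>)"
    unfolding gq
    by (rule integral_cong_AE) (use weight_nonneg in \<open>auto simp: abs_mult elim: eventually_mono\<close>)
  finally show ?thesis by (simp add: mult.commute)
qed

text \<open>Raised to the power p / (1 - \<alpha>), the previous bound becomes B^p times the power
  \<open>C\<close> of the energy of u, and B \<le> R by Hoelder's inequality for the pairing. If the
  two ends agree, so do B^p and R^p, because \<open>C\<close> is positive.\<close>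

lemma weighted_integral_powr_le:
  assumes v: "v \<in> frac_sobolev0 s p \<Omega>"
  shows "weighted_integral \<alpha> \<Omega> \<omega> v powr (p / (1 - \<alpha>)) \<le> energy u powr ((p - 1 + \<alpha>) / (1 - \<alpha>)) * energy v"
    and "weighted_integral \<alpha> \<Omega> \<omega> v powr (p / (1 - \<alpha>)) = energy u powr ((p - 1 + \<alpha>) / (1 - \<alpha>)) * energy v \<Longrightarrow>
      (LINT x|lborel. weight x * \<bar>v x\<bar>) = energy u powr (1 - 1 / p) * energy v powr (1 / p)"
proof -
  let ?W = "weighted_integral \<alpha> \<Omega> \<omega> v"
  define B where "B = (LINT x|lborel. weight x * \<bar>v x\<bar>)"
  define R where "R = energy u powr (1 - 1 / p) * energy v powr (1 / p)"
  define C where "C = energy u powr (\<alpha> * (p / (1 - \<alpha>)))"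
  have C: "0 < C" unfolding C_def using energy_u_pos by simp
  have B: "0 \<le> B"
    unfolding B_def
    by (rule integral_nonneg_AE) (use weight_nonneg in \<open>auto elim: eventually_mono\<close>)
  have BR: "B \<le> R" unfolding B_def R_def by (rule weak_form_abs_bound(3)[OF v])
  have "?W powr (p / (1 - \<alpha>)) \<le> (B powr (1 - \<alpha>) * energy u powr \<alpha>) powr (p / (1 - \<alpha>))"
    using weighted_integral_le[OF v] weighted_integral_nonneg p \<alpha> unfolding B_def by (intro powr_mono2) auto
  also have "\<dots> = B powr p * C"
  proof -
    have "(B powr (1 - \<alpha>) * E powr \<alpha>) powr (p / (1 - \<alpha>)) = B powr p * E powr (\<alpha> * (p / (1 - \<alpha>)))" for E
      using \<alpha> by (simp add: powr_mult powr_powr)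
    thus ?thesis unfolding C_def .
  qed
  finally have 1: "?W powr (p / (1 - \<alpha>)) \<le> B powr p * C" .
  have 2: "B powr p * C \<le> R powr p * C" using B BR C p by (intro mult_right_mono powr_mono2) auto
  have "(E powr (1 - 1 / p) * G powr (1 / p)) powr p = E powr (p - 1) * G" if "0 \<le> G" for E G
    using p that by (simp add: powr_mult powr_powr left_diff_distrib)
  hence "R powr p = energy u powr (p - 1) * energy v" unfolding R_def by simp
  moreover have "p - 1 + \<alpha> * (p / (1 - \<alpha>)) = (p - 1 + \<alpha>) / (1 - \<alpha>)"
    using \<alpha> by (simp add: field_simps)
  ultimately have R: "R powr p * C = energy u powr ((p - 1 + \<alpha>) / (1 - \<alpha>)) * energy v"
    unfolding C_def by (simp add: mult_ac powr_add[symmetric])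
  show "?W powr (p / (1 - \<alpha>)) \<le> energy u powr ((p - 1 + \<alpha>) / (1 - \<alpha>)) * energy v"
    using 1 2 unfolding R by linarith
  assume "?W powr (p / (1 - \<alpha>)) = energy u powr ((p - 1 + \<alpha>) / (1 - \<alpha>)) * energy v"
  hence "B powr p * C = R powr p * C" using 1 2 unfolding R by linarith
  hence "B powr p = R powr p" using C by simp
  hence "(B powr p) powr (1 / p) = (R powr p) powr (1 / p)" by simp
  thus "(LINT x|lborel. weight x * \<bar>v x\<bar>) = energy u powr (1 - 1 / p) * energy v powr (1 / p)"
    using B BR p unfolding B_def[symmetric] R_def[symmetric] by (simp add: powr_powr)
qed

section \<open>The equality case\<close>

text \<open>With zero energy, v would be almost everywhere equal to a constant, and comparison with
  a point outside \<Omega> shows this constant to be 0.\<close>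

lemma energy_pos:
  assumes v: "v \<in> frac_sobolev0 s p \<Omega>" and nz: "\<not> (AE x in lborel. v x = 0)"
  shows "0 < energy v"
proof (rule ccontr)
  note vs = frac_sobolev0_D[OF v]
  assume "\<not> 0 < energy v"
  hence "(LINT z|Q. \<bar>D v z\<bar> powr p) = 0" by (simp add: less_le gagliardo_powr[OF p_pos])
  hence "AE z in Q. \<bar>D v z\<bar> powr p = 0"
    using vs integral_nonneg_eq_0_iff_AE[of Q "\<lambda>z. \<bar>D v z\<bar> powr p"] frac_sobolev_iff[OF p_pos, of v s] by simp
  hence "AE z in Q. v (fst z) = v (snd z)"
    by eventually_elim (auto simp: diff_quot_def)
  from lborel_pair.AE_pair[OF this] have "AE x in lborel. AE y in lborel. v x = v y" by simp
  with frac_sobolev0_AE_zero[OF s p_pos v]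
  have "AE x in lborel. (x \<notin> \<Omega> \<longrightarrow> v x = 0) \<and> (AE y in lborel. v x = v y)" by eventually_elim simp
  then obtain x where "x \<notin> \<Omega>" "(x \<notin> \<Omega> \<longrightarrow> v x = 0) \<and> (AE y in lborel. v x = v y)"
    by (rule ex_outside_bounded[OF bounded_domain open_domain])
  hence "AE y in lborel. v y = 0" by (auto elim: eventually_mono)
  with nz show False by blast
qed

lemma equality_imp_proportional:
  assumes v: "v \<in> frac_sobolev0 s p \<Omega>"
    and eq: "weighted_integral \<alpha> \<Omega> \<omega> v powr (p / (1 - \<alpha>)) = energy u powr ((p - 1 + \<alpha>) / (1 - \<alpha>)) * energy v"
  shows "\<exists>k. AE x in lborel. v x = k * u x"
\<comment> \<open>The equality case of Hoelder's inequality requires both energies to be positive,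
  so v = 0 is split off.\<close>
proof (cases "AE x in lborel. v x = 0")
  case True
  thus ?thesis by (auto intro!: exI[of _ 0])
next
  case False
  note vs = frac_sobolev0_D[OF v] and us = frac_sobolev0_D[OF u_frac_sobolev0]
  note [measurable] = vs(2)
  note av = frac_sobolev_abs[OF p_pos vs(1)]
  let ?v = "\<lambda>x. \<bar>v x\<bar>"
  define k where "k = (energy v / energy u) powr (1 / p)"
  define h where "h z = \<bar>D u z\<bar> powr (p - 1) * \<bar>D v z\<bar>" for z
  define P where "P z = \<bar>D u z\<bar> powr (p - 2) * D u z * D ?v z" for z
  have B: "(LINT x|lborel. weight x * \<bar>v x\<bar>) = energy u powr (1 - 1 / p) * energy v powr (1 / p)"
    by (rule weighted_integral_powr_le(2)[OF v eq])
  have hI: "integrable Q h" and PI: "integrable Q P" unfolding h_def P_def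
    by (rule frac_p_Laplacian_integrable(1)[OF p us(1) vs(1)], rule frac_p_Laplacian_integrable(2)[OF p us(1) av])
  have Pint: "integral\<^sup>L Q P = pairing ?v"
    unfolding P_def frac_p_Laplacian_diff_quot[OF p_pos] ..
  \<comment> \<open>The weighted integral of |v| is the lower end of the chain and by
    \<open>B\<close> equals its upper end, so all links are equalities.\<close>
  have H: "integral\<^sup>L Q h = energy u powr (1 - 1 / p) * energy v powr (1 / p)"
    and HP: "integral\<^sup>L Q h = integral\<^sup>L Q P"
    unfolding h_def Pint using B weak_form_abs(2)[OF v] weak_form_abs_bound(1,2)[OF v] by linarith+
  have ae1: "AE z in Q. \<bar>D v z\<bar> = k * \<bar>D u z\<bar>"
  proof -
    have "AE z in Q. \<bar>D v z\<bar> = ((LINT z|Q. \<bar>D v z\<bar> powr p) / (LINT z|Q. \<bar>D u z\<bar> powr p)) powr (1 / p) * \<bar>D u z\<bar>"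
    proof (rule Hoelder_powr(2)[OF p])
      show "(LINT z|Q. \<bar>D u z\<bar> powr (p - 1) * \<bar>D v z\<bar>)
          = (LINT z|Q. \<bar>D u z\<bar> powr p) powr (1 - 1 / p) * (LINT z|Q. \<bar>D v z\<bar> powr p) powr (1 / p)"
        using H unfolding h_def by (simp add: gagliardo_powr[OF p_pos])
    qed (use us vs frac_sobolev_iff[OF p_pos, of _ s] energy_u_pos energy_pos[OF v False] in
        \<open>auto simp: gagliardo_powr[OF p_pos]\<close>)
    thus ?thesis unfolding k_def gagliardo_powr[OF p_pos] .
  qed
  have ae2: "AE z in Q. h z = P z"
  proof -
    have nn: "0 \<le> h z - P z" for z
    proof -
      have "P z \<le> \<bar>D u z\<bar> powr (p - 1) * \<bar>D ?v z\<bar>"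
        using abs_powr_mult_self[of "D u z" p "D ?v z"] unfolding P_def by linarith
      also have "\<dots> \<le> h z" unfolding h_def by (intro mult_left_mono abs_diff_quot_le) auto
      finally show ?thesis by simp
    qed
    have "integral\<^sup>L Q (\<lambda>z. h z - P z) = 0" using HP hI PI by simp
    hence "AE z in Q. h z - P z = 0"
      using integral_nonneg_eq_0_iff_AE[of Q "\<lambda>z. h z - P z"] hI PI nn by simp
    thus ?thesis by eventually_elim simp
  qed
  have "AE z in Q. ?v (fst z) - ?v (snd z) = k * (u (fst z) - u (snd z)) \<and>
      \<bar>?v (fst z) - ?v (snd z)\<bar> = \<bar>v (fst z) - v (snd z)\<bar>"
    using ae1 ae2
  proof eventually_elim
    case (elim z)
    \<comment> \<open>Where the quotient of u is nonzero its power p - 2 cancels, leaving |D u| |D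
      v| = D u D |v|, into which |D v| = k |D u| is inserted. Where it is 0, the quotient of v
      vanishes by \<open>ae1\<close>, and with it that of |v|.\<close>
    have D: "D ?v z = k * D u z" and absD: "\<bar>D ?v z\<bar> = \<bar>D v z\<bar>"
    proof -
      have le: "\<bar>D ?v z\<bar> \<le> \<bar>D v z\<bar>" by (rule abs_diff_quot_le) simp
      show "D ?v z = k * D u z"
      proof (cases "D u z = 0")
        case True
        thus ?thesis using le elim by simp
      next
        case False
        have e: "\<bar>D u z\<bar> powr (p - 1) = \<bar>D u z\<bar> powr (p - 2) * \<bar>D u z\<bar>"
          using abs_powr_mult_self[of "D u z" p 1] by (simp add: abs_mult)
        have "\<bar>D u z\<bar> powr (p - 2) * (\<bar>D u z\<bar> * \<bar>D v z\<bar>) = \<bar>D u z\<bar> powr (p - 2) * (D u z * D ?v z)"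
          using elim(2) unfolding h_def P_def e by (simp only: mult.assoc)
        hence "\<bar>D u z\<bar> * \<bar>D v z\<bar> = D u z * D ?v z" using False by simp
        hence "D u z * D ?v z = \<bar>D u z\<bar> * (k * \<bar>D u z\<bar>)" unfolding elim(1) by (rule sym)
        also have "\<dots> = k * (\<bar>D u z\<bar> * \<bar>D u z\<bar>)" by (rule mult.left_commute)
        also have "\<dots> = D u z * (k * D u z)" by (simp only: abs_mult_self_eq mult.left_commute)
        finally have "D u z * D ?v z = D u z * (k * D u z)" .
        thus ?thesis using mult_left_cancel[OF False] by blast
      qed
      thus "\<bar>D ?v z\<bar> = \<bar>D v z\<bar>" using elim(1) by (simp add: abs_mult k_def)
    qed
    show ?case
    \<comment> \<open>Off the diagonal the kernel is nonzero and can be cancelled; on it all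
      differences are 0.\<close>
    proof (cases "fst z = snd z")
      case False
      hence "norm (fst z - snd z) powr ((real DIM('a) + s * p) / p) \<noteq> 0" by simp
      thus ?thesis using D absD unfolding diff_quot_def by (auto simp: abs_divide)
    qed simp
  qed
  from lborel_pair.AE_pair[OF this]
  have pairs: "AE x in lborel. AE y in lborel.
      ?v x - ?v y = k * (u x - u y) \<and> \<bar>?v x - ?v y\<bar> = \<bar>v x - v y\<bar>" by simp
  with frac_sobolev0_AE_zero[OF s p_pos v] frac_sobolev0_AE_zero[OF s p_pos u_frac_sobolev0]
  have "AE x in lborel. (x \<notin> \<Omega> \<longrightarrow> v x = 0 \<and> u x = 0) \<and> (AE y in lborel. ?v x - ?v y = k * (u x - u y))"
    by eventually_elim (auto elim: eventually_mono)
  then obtain x0 where "x0 \<notin> \<Omega>"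
    "(x0 \<notin> \<Omega> \<longrightarrow> v x0 = 0 \<and> u x0 = 0) \<and> (AE y in lborel. ?v x0 - ?v y = k * (u x0 - u y))"
    by (rule ex_outside_bounded[OF bounded_domain open_domain])
  hence abs_v: "AE y in lborel. \<bar>v y\<bar> = k * u y" by (auto elim: eventually_mono)
  \<comment> \<open>Equality in the reverse triangle inequality excludes opposite signs, so
    comparison with a single point where v is nonzero fixes the sign of v almost everywhere.\<close>
  obtain x1 where x1: "v x1 \<noteq> 0" "AE y in lborel. \<bar>?v x1 - ?v y\<bar> = \<bar>v x1 - v y\<bar>"
  proof -
    have "\<exists>x. v x \<noteq> 0 \<and> (AE y in lborel. \<bar>?v x - ?v y\<bar> = \<bar>v x - v y\<bar>)"
    proof (rule ccontr)
      assume contra: "\<not> ?thesis"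
      from pairs have "AE x in lborel. v x = 0"
      proof eventually_elim
        case (elim x)
        hence "AE y in lborel. \<bar>?v x - ?v y\<bar> = \<bar>v x - v y\<bar>" by eventually_elim blast
        with contra show ?case by blast
      qed
      with False show False by blast
    qed
    thus thesis using that by blast
  qed
  have "AE y in lborel. v y = (sgn (v x1) * k) * u y"
    using abs_v x1(2)
  proof eventually_elim
    case (elim y)
    have "v y = sgn (v x1) * \<bar>v y\<bar>" using elim(2) x1(1) by (auto simp: sgn_if abs_if split: if_splits)
    thus ?case using elim(1) by simp
  qed
  thus ?thesis by blast
qed

section \<open>The normalized solution and the minimizers\<close>

lemma normalized_eq: "normalized \<alpha> \<Omega> \<omega> u = (\<lambda>x. energy u powr (- 1 / (1 - \<alpha>)) * u x)"
  unfolding normalized_def weighted_integral_u ..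

lemma normalized_in_constraint_set: "normalized \<alpha> \<Omega> \<omega> u \<in> constraint_set s p \<alpha> \<Omega> \<omega>"
proof -
  have one: "\<bar>E powr (- 1 / (1 - \<alpha>))\<bar> powr (1 - \<alpha>) * E = 1" if "0 < E" for E :: real
  proof -
    have "\<bar>E powr (- 1 / (1 - \<alpha>))\<bar> powr (1 - \<alpha>) = E powr (- 1 / (1 - \<alpha>) * (1 - \<alpha>))"
      by (simp only: powr_powr abs_of_nonneg powr_ge_zero)
    also have "- 1 / (1 - \<alpha>) * (1 - \<alpha>) = - 1" using \<alpha> by simp
    finally show ?thesis using that by (simp add: powr_minus_divide)
  qed
  have "weighted_integral \<alpha> \<Omega> \<omega> (normalized \<alpha> \<Omega> \<omega> u) = 1"
    unfolding normalized_eq weighted_integral_cmult weighted_integral_u using one[OF energy_u_pos] .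
  thus ?thesis
    unfolding constraint_set_def normalized_eq using frac_sobolev0_cmult[OF p_pos u_frac_sobolev0] by simp
qed

text \<open>The value is the reciprocal of the constant in \<open>weighted_integral_powr_le\<close>,
  which thereby turns into a lower bound for energies with the energy of the normalized solution as
  its constant.\<close>

lemma energy_normalized: "energy (normalized \<alpha> \<Omega> \<omega> u) = 1 / energy u powr ((p - 1 + \<alpha>) / (1 - \<alpha>))"
proof -
  have "energy (normalized \<alpha> \<Omega> \<omega> u) = energy u powr (- p / (1 - \<alpha>)) * energy u powr 1"
    unfolding normalized_eq gagliardo_cmult_powr[OF p_pos] using energy_u_pos by (simp add: powr_powr)
  also have "\<dots> = energy u powr (- p / (1 - \<alpha>) + 1)" by (rule powr_add[symmetric])
  also have "- p / (1 - \<alpha>) + 1 = - ((p - 1 + \<alpha>) / (1 - \<alpha>))" using \<alpha> by (simp add: field_simps)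
  finally show ?thesis by (simp add: powr_minus_divide)
qed

lemma weighted_integral_powr_le_normalized:
  assumes "v \<in> frac_sobolev0 s p \<Omega>"
  shows "energy (normalized \<alpha> \<Omega> \<omega> u) * weighted_integral \<alpha> \<Omega> \<omega> v powr (p / (1 - \<alpha>)) \<le> energy v"
  using weighted_integral_powr_le(1)[OF assms] energy_u_pos
  unfolding energy_normalized by (simp add: field_simps)

lemma equality_imp_multiple_normalized:
  assumes v: "v \<in> frac_sobolev0 s p \<Omega>"
    and "energy (normalized \<alpha> \<Omega> \<omega> u) * weighted_integral \<alpha> \<Omega> \<omega> v powr (p / (1 - \<alpha>)) = energy v"
  shows "\<exists>k. AE x in lborel. v x = k * normalized \<alpha> \<Omega> \<omega> u x"
proof -
  have "weighted_integral \<alpha> \<Omega> \<omega> v powr (p / (1 - \<alpha>)) = energy u powr ((p - 1 + \<alpha>) / (1 - \<alpha>)) * energy v"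
    using assms(2) energy_u_pos unfolding energy_normalized by (simp add: field_simps)
  then obtain k where k: "AE x in lborel. v x = k * u x" using equality_imp_proportional[OF v] by blast
  let ?t = "energy u powr (- 1 / (1 - \<alpha>))"
  have "AE x in lborel. v x = (k / ?t) * normalized \<alpha> \<Omega> \<omega> u x"
    using k by eventually_elim (use energy_u_pos in \<open>simp add: normalized_eq\<close>)
  thus ?thesis by blast
qed

lemma weighted_integral_cong_AE:
  assumes [measurable]: "v \<in> borel_measurable borel" "w \<in> borel_measurable borel"
    and "AE x in lborel. v x = w x"
  shows "weighted_integral \<alpha> \<Omega> \<omega> v = weighted_integral \<alpha> \<Omega> \<omega> w"
  unfolding weighted_integral_alt
proof (rule integral_cong_AE)
  show "AE x in lborel. indicator \<Omega> x *\<^sub>R \<omega> x * \<bar>v x\<bar> powr (1 - \<alpha>) = indicator \<Omega> x *\<^sub>R \<omega> x * \<bar>w x\<bar> powr (1 - \<alpha>)"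
    using assms(3) by eventually_elim simp
qed measurable

lemma constraint_set_energy_ge:
  assumes "v \<in> constraint_set s p \<alpha> \<Omega> \<omega>"
  shows "energy (normalized \<alpha> \<Omega> \<omega> u) \<le> energy v"
  using assms weighted_integral_powr_le_normalized[of v] unfolding constraint_set_def by simp

lemma minimal_energy_eq: "minimal_energy s p \<alpha> \<Omega> \<omega> = energy (normalized \<alpha> \<Omega> \<omega> u)"
  unfolding minimal_energy_def
  by (rule cInf_eq_minimum) (use normalized_in_constraint_set constraint_set_energy_ge in auto)

text \<open>On the constraint set the weighted integral is 1, so a minimizer attains equality in the
  bound and is k times the normalized solution; the constraint then gives |k|^(1 - \<alpha>) = 1.
  Membership in the Sobolev space stands on the right because a function almost everywhere equal to
  a Borel function need not be Borel measurable.\<close>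

lemma minimizer_iff:
  "is_arg_min (\<lambda>w. gagliardo s p w powr p) (\<lambda>w. w \<in> constraint_set s p \<alpha> \<Omega> \<omega>) v \<longleftrightarrow>
     v \<in> frac_sobolev0 s p \<Omega> \<and>
     ((AE x in lborel. v x = normalized \<alpha> \<Omega> \<omega> u x) \<or> (AE x in lborel. v x = - normalized \<alpha> \<Omega> \<omega> u x))"
  (is "?L \<longleftrightarrow> _ \<and> (?pos \<or> ?neg)")
proof
  let ?U = "normalized \<alpha> \<Omega> \<omega> u"
  have U: "?U \<in> frac_sobolev0 s p \<Omega>" "weighted_integral \<alpha> \<Omega> \<omega> ?U = 1"
    using normalized_in_constraint_set unfolding constraint_set_def by auto
  note [measurable] = frac_sobolev0_D(2)[OF U(1)]
  {
    assume L: ?L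
    hence v: "v \<in> frac_sobolev0 s p \<Omega>" and w: "weighted_integral \<alpha> \<Omega> \<omega> v = 1"
      and "energy v \<le> energy ?U"
      using normalized_in_constraint_set unfolding is_arg_min_def constraint_set_def by (auto simp: not_less)
    hence "energy v = energy ?U" using weighted_integral_powr_le_normalized[OF v] by simp
    then obtain k where k: "AE x in lborel. v x = k * ?U x"
      using equality_imp_multiple_normalized[OF v] w by auto
    have "1 = weighted_integral \<alpha> \<Omega> \<omega> (\<lambda>x. k * ?U x)"
      using weighted_integral_cong_AE[OF frac_sobolev0_D(2)[OF v] _ k] w by simp
    hence "\<bar>k\<bar> powr (1 - \<alpha>) = 1" unfolding weighted_integral_cmult U by simp
    hence "(\<bar>k\<bar> powr (1 - \<alpha>)) powr (1 / (1 - \<alpha>)) = 1" by simp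
    hence "\<bar>k\<bar> = 1" using \<alpha> by (simp add: powr_powr)
    hence "k = 1 \<or> k = -1" by linarith
    hence "?pos \<or> ?neg"
    proof
      assume "k = 1"
      thus ?thesis using k by simp
    next
      assume "k = -1"
      thus ?thesis using k by simp
    qed
    with v show "v \<in> frac_sobolev0 s p \<Omega> \<and> (?pos \<or> ?neg)" by blast
  }
  assume R: "v \<in> frac_sobolev0 s p \<Omega> \<and> (?pos \<or> ?neg)"
  then obtain c where c: "\<bar>c\<bar> = 1" "AE x in lborel. v x = c * ?U x"
  proof -
    from R consider ?pos | ?neg by blast
    thus thesis using that[of 1] that[of "-1"] by cases simp_all
  qed
  have vm: "v \<in> borel_measurable borel" using R frac_sobolev0_D(2) by blast
  have "weighted_integral \<alpha> \<Omega> \<omega> v = 1"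
    using weighted_integral_cong_AE[OF vm _ c(2)] c(1) by (simp add: weighted_integral_cmult U)
  moreover have "energy v = energy ?U"
    using gagliardo_cong_AE[OF vm _ p_pos c(2), of s] c(1) by (simp add: gagliardo_cmult_powr[OF p_pos])
  ultimately show ?L
    using R constraint_set_energy_ge unfolding is_arg_min_def constraint_set_def by (auto simp: not_less)
qed

end

section \<open>Integrability of the weight\<close>

text \<open>As \<Omega> has finite measure, constants are integrable on it. For r = \<infinity> a
  constant dominates |f|, for finite r the function 1 + |f|^r does.\<close>

lemma Lebesgue_space_integrable:
  assumes "bounded \<Omega>" "open \<Omega>" "1 \<le> r" "f \<in> Lebesgue_space r \<Omega>"
  shows "set_integrable lborel \<Omega> f"
proof -
  have m: "set_borel_measurable lborel \<Omega> f" using assms unfolding Lebesgue_space_def by blast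
  have fin: "emeasure lborel \<Omega> < \<infinity>" by (rule emeasure_bounded_finite[OF assms(1)])
  have O [measurable]: "\<Omega> \<in> sets lborel" using assms by simp
  show ?thesis
  proof (cases "r = \<infinity>")
    case True
    then obtain C where C: "AE x\<in>\<Omega> in lborel. \<bar>f x\<bar> \<le> C"
      using assms unfolding Lebesgue_space_def by auto
    show ?thesis unfolding set_integrable_def
      by (rule integrableI_bounded_set[where A = \<Omega> and B = C])
        (use m fin O C in \<open>auto simp: set_borel_measurable_def elim: eventually_mono\<close>)
  next
    case False
    then obtain q where q: "r = ereal q" "1 \<le> q" using assms(3) by (cases r) auto
    hence i: "set_integrable lborel \<Omega> (\<lambda>x. \<bar>f x\<bar> powr q)"
      using assms unfolding Lebesgue_space_def by auto
    have one: "set_integrable lborel \<Omega> (\<lambda>x. 1 :: real)"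
      unfolding set_integrable_def using O fin by (intro integrable_scaleR_left integrable_real_indicator) auto
    have "\<bar>f x\<bar> \<le> 1 + \<bar>f x\<bar> powr q" for x
    proof (cases "\<bar>f x\<bar> \<le> 1")
      case False
      hence "\<bar>f x\<bar> powr 1 \<le> \<bar>f x\<bar> powr q" using q by (intro powr_mono) auto
      thus ?thesis using False by simp
    qed (simp add: add_increasing2)
    hence "\<bar>indicator \<Omega> x *\<^sub>R f x\<bar> \<le> \<bar>indicator \<Omega> x *\<^sub>R (1 + \<bar>f x\<bar> powr q)\<bar>" for x
      by (auto simp: indicator_def)
    hence "AE x in lborel. norm (indicator \<Omega> x *\<^sub>R f x) \<le> norm (indicator \<Omega> x *\<^sub>R (1 + \<bar>f x\<bar> powr q))" by simp
    with set_integral_add(1)[OF one i] m show ?thesis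
      unfolding set_integrable_def set_borel_measurable_def
      by (rule Bochner_Integration.integrable_bound)
  qed
qed

text \<open>In the subcritical case N p > N - s p > 0 makes the Sobolev exponent exceed 1, and
  division by 1 - \<alpha> keeps it so; the conjugate t / (t - 1) of such a number is above 1.
  Otherwise the value is 1 / \<alpha> with \<alpha> < 1.\<close>

lemma weight_exponent_ge_1:
  assumes "0 < s" "1 < p" "0 < \<alpha>" "\<alpha> < 1" "0 < N"
  shows "1 \<le> weight_exponent N s p \<alpha>"
proof (cases "s * p < N")
  case True
  define t where "t = sobolev_exponent N s p / (1 - \<alpha>)"
  have "1 < N * p / (N - s * p)"
  proof -
    have "N - s * p < N" using assms by simp
    also have "\<dots> < N * p" using assms by simp
    finally show ?thesis using True by simp
  qed
  hence X: "1 < sobolev_exponent N s p" unfolding sobolev_exponent_def .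
  hence "sobolev_exponent N s p * (1 - \<alpha>) \<le> sobolev_exponent N s p * 1"
    using assms by (intro mult_left_mono) auto
  hence "sobolev_exponent N s p \<le> t"
    unfolding t_def using assms by (simp add: pos_le_divide_eq)
  with X have "1 < t" by linarith
  thus ?thesis using True unfolding weight_exponent_def hoelder_conjugate_def t_def[symmetric] by simp
qed (use assms in \<open>simp add: weight_exponent_def\<close>)

theorem proposition3p0p4:
  fixes \<Omega> :: "'a::euclidean_space set"
    and s p \<alpha> :: real and r :: ereal
    and \<omega> u :: "'a \<Rightarrow> real"
  defines "U \<equiv> normalized \<alpha> \<Omega> \<omega> u"
  assumes "DIM('a) \<ge> 2"
    and "bounded_smooth_domain \<Omega>"
    and "0 < s" "s < 1" "1 < p" "0 < \<alpha>" "\<alpha> < 1"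
    and "ereal (weight_exponent (real DIM('a)) s p \<alpha>) \<le> r"
    and "\<omega> \<in> Lebesgue_space r \<Omega>"
    and "\<not> (AE x\<in>\<Omega> in lborel. \<omega> x = 0)"
    and "AE x\<in>\<Omega> in lborel. 0 \<le> \<omega> x"
    and "weak_solution s p \<alpha> \<Omega> \<omega> u"
  shows "(\<forall>v. is_arg_min (\<lambda>w. gagliardo s p w powr p) (\<lambda>w. w \<in> constraint_set s p \<alpha> \<Omega> \<omega>) v \<longleftrightarrow>
            v \<in> frac_sobolev0 s p \<Omega> \<and>
            ((AE x in lborel. v x = U x) \<or> (AE x in lborel. v x = - U x)))
       \<and> minimal_energy s p \<alpha> \<Omega> \<omega> = gagliardo s p U powr p
       \<and> (\<forall>v\<in>frac_sobolev0 s p \<Omega>.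
            \<not> (AE x in lborel. v x = 0) \<longrightarrow>
            minimal_energy s p \<alpha> \<Omega> \<omega> * weighted_integral \<alpha> \<Omega> \<omega> v powr (p / (1 - \<alpha>))
              = gagliardo s p v powr p \<longrightarrow>
            (\<exists>k. AE x in lborel. v x = k * U x))"
proof -
  have \<Omega>: "open \<Omega>" "bounded \<Omega>" using assms unfolding bounded_smooth_domain_def by auto
  \<comment> \<open>An exponent of at least 1 on a bounded set makes \<omega> integrable, which is
    the form in which the locale takes the condition on r.\<close>
  have "1 \<le> weight_exponent (real DIM('a)) s p \<alpha>" by (rule weight_exponent_ge_1) (use assms in auto)
  hence "1 \<le> ereal (weight_exponent (real DIM('a)) s p \<alpha>)" by simp
  hence "1 \<le> r" using \<open>ereal (weight_exponent (real DIM('a)) s p \<alpha>) \<le> r\<close> by (rule order_trans)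
  hence "set_integrable lborel \<Omega> \<omega>" using Lebesgue_space_integrable \<Omega> assms by blast
  then interpret singular_problem \<Omega> s p \<alpha> \<omega> u
    using \<Omega> assms by unfold_locales auto
  show ?thesis
    unfolding U_def minimal_energy_eq
    using minimizer_iff equality_imp_multiple_normalized by blast
qed

end
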